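(* a) Let $0<p<1$. Then there exists a constant $c_p>0$, depending only on $p$, such that for every $f\in H_p(G_m)$ and every positive integer $n$, $$\|S_nf\|_{H_p}\le \frac{c_p\,M_{|n|}^{1/p-1}}{M_{\langle n\rangle}^{1/p-1}}\,\|f\|_{H_p}.$$ b) Let $0<p<1$, let $\{n_k:k\in\mathbb{N}\}$ be an increasing sequence of positive integers such that $\sup_{k\in\mathbb{N}}\rho(n_k)=\infty$, and let $\{\Phi_n:n\in\mathbb{N}\}$ be any non-decreasing sequence of positive real numbers satisfying $$\limsup_{k\to\infty}\frac{M_{|n_k|}^{1/p-1}}{M_{\langle n_k\rangle}^{1/p-1}\,\Phi_{n_k}}=\infty .$$ Then there exists a martingale $f\in H_p(G_m)$ such that $$\sup_{k\in\mathbb{N}}\left\|\frac{S_{n_k}f}{\Phi_{n_k}}\right\|_{L_{p,\infty}}=\infty .$$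
   Context: $\mathbb{N}=\{0,1,2,\dots\}$. Fix a bounded sequence $m=(m_0,m_1,\dots)$ of integers $m_k\ge 2$; constants "depending only on $p$" are understood for this fixed $m$. Let $Z_{m_k}=\{0,1,\dots,m_k-1\}$ be the additive group of integers modulo $m_k$, and $G_m=\prod_{k\ge0}Z_{m_k}$ with the product topology and normalized Haar measure $\mu$ (the product of the uniform probability measures on the $Z_{m_k}$). Elements are $x=(x_0,x_1,\dots)$. Put $I_0(x)=G_m$ and $I_n(x)=\{y\in G_m: y_0=x_0,\dots,y_{n-1}=x_{n-1}\}$. Put $M_0=1$, $M_{k+1}=m_kM_k$. Every $n\in\mathbb{N}$ is uniquely $n=\sum_{j\ge0}n_jM_j$ with $n_j\in Z_{m_j}$, only finitely many nonzero. For $n\ge1$: $\langle n\rangle=\min\{j:n_j\ne0\}$, $|n|=\max\{j:n_j\neq0\}$, $\rho(n)=|n|-\langle n\rangle$. Vilenkin system: $r_k(x)=\exp(2\pi i x_k/m_k)$, $\psi_n(x)=\prod_{k\ge0}r_k^{n_k}(x)$. Let $\digamma_n$ be the $\sigma$-algebra generated by $\{I_n(x):x\in G_m\}$. Martingales $f=(f_n)_{n\in\mathbb{N}}$ are complex-valued and with respect to $(\digamma_n)$. Fourier coefficients: $\widehat f(i)=\lim_{k\to\infty}\int_{G_m}f_k\overline{\psi_i}\,d\mu$. Partial sums: $S_nf=\sum_{k=0}^{n-1}\widehat f(k)\psi_k$. Maximal function: $f^*=\sup_n|f_n|$. $H_p(G_m)$ is the set of martingales with $\|f\|_{H_p}:=\|f^*\|_p=(\int_{G_m}|f^*|^p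 d\mu)^{1/p}<\infty$. An integrable function $g$ (e.g. $S_nf$) is identified with the martingale $(S_{M_n}g)_{n}$. For measurable $g$, $\|g\|_{L_{p,\infty}}=\sup_{\lambda>0}\lambda\,\mu(|g|>\lambda)^{1/p}$. *)

theory Defs
  imports "HOL-Probability.Probability"
begin

section \<open>The generalised number system\<close>

primrec vil_M :: "(nat \<Rightarrow> nat) \<Rightarrow> nat \<Rightarrow> nat" where
  "vil_M m 0 = 1"
| "vil_M m (Suc k) = m k * vil_M m k"

text \<open>
  The digits of \<open>n\<close> with respect to \<open>M\<^sub>0, M\<^sub>1, \<dots>\<close>, by the usual division algorithm; the lemmas
  \<open>vil_digit_expansion\<close> and \<open>vil_digit_unique\<close> below show that they form the unique expansion
  \<open>n = \<Sum>\<^sub>j n\<^sub>j M\<^sub>j\<close> with \<open>0 \<le> n\<^sub>j < m\<^sub>j\<close>.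
\<close>

definition vil_digit :: "(nat \<Rightarrow> nat) \<Rightarrow> nat \<Rightarrow> nat \<Rightarrow> nat" where
  "vil_digit m n j = (n div vil_M m j) mod m j"

definition vil_supp :: "(nat \<Rightarrow> nat) \<Rightarrow> nat \<Rightarrow> nat set" where
  "vil_supp m n = {j. vil_digit m n j \<noteq> 0}"

definition vil_low :: "(nat \<Rightarrow> nat) \<Rightarrow> nat \<Rightarrow> nat" where
  "vil_low m n = Min (vil_supp m n)"

definition vil_high :: "(nat \<Rightarrow> nat) \<Rightarrow> nat \<Rightarrow> nat" where
  "vil_high m n = Max (vil_supp m n)"

definition vil_rho :: "(nat \<Rightarrow> nat) \<Rightarrow> nat \<Rightarrow> nat" where
  "vil_rho m n = vil_high m n - vil_low m n"

lemma vil_M_gt: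
  assumes "\<And>k. 2 \<le> m k"
  shows "k < vil_M m k"
proof (induction k)
  case (Suc k)
  have "Suc k < 2 * vil_M m k" using Suc by simp
  also have "\<dots> \<le> vil_M m (Suc k)" using assms by simp
  finally show ?case .
qed simp

lemma vil_digit_less:
  assumes "\<And>k. 2 \<le> m k"
  shows "vil_digit m n j < m j"
  using assms[of j] by (simp add: vil_digit_def)

lemma vil_digit_sum_mod: "(\<Sum>j<N. vil_digit m n j * vil_M m j) = n mod vil_M m N"
proof (induction N)
  case (Suc N)
  have "n mod (vil_M m N * m N) = vil_M m N * (n div vil_M m N mod m N) + n mod vil_M m N"
    by (rule mod_mult2_eq)
  then show ?case using Suc by (simp add: vil_digit_def mult.commute)
qed simp

lemma vil_digit_eq_0:
  assumes "\<And>k. 2 \<le> m k" and "n \<le> j"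
  shows "vil_digit m n j = 0"
proof -
  have "n < vil_M m j" using vil_M_gt[of m j] assms by (meson le_less_trans)
  then show ?thesis by (simp add: vil_digit_def)
qed

lemma finite_vil_supp:
  assumes "\<And>k. 2 \<le> m k"
  shows "finite (vil_supp m n)"
proof (rule finite_subset)
  show "vil_supp m n \<subseteq> {..<n}"
    using vil_digit_eq_0[OF assms] by (force simp: vil_supp_def not_less[symmetric])
qed simp

lemma vil_digit_expansion:
  assumes "\<And>k. 2 \<le> m k"
  shows "n = (\<Sum>j\<in>vil_supp m n. vil_digit m n j * vil_M m j)"
proof -
  have "(\<Sum>j\<in>vil_supp m n. vil_digit m n j * vil_M m j) = (\<Sum>j<n. vil_digit m n j * vil_M m j)"
    using vil_digit_eq_0[OF assms]
    by (intro sum.mono_neutral_left) (force simp: vil_supp_def not_less[symmetric])+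
  also have "\<dots> = n"
    using vil_M_gt[of m n] assms by (simp add: vil_digit_sum_mod)
  finally show ?thesis by simp
qed

lemma vil_digit_unique:
  assumes m: "\<And>k. 2 \<le> m k"
    and fin: "finite {j. a j \<noteq> 0}" and less: "\<And>j. a j < m j"
    and n: "n = (\<Sum>j | a j \<noteq> 0. a j * vil_M m j)"
  shows "a j = vil_digit m n j"
proof -
  have Mpos: "0 < vil_M m k" for k using vil_M_gt[of m k] m by simp
  have bound: "(\<Sum>j<N. a j * vil_M m j) < vil_M m N" for N
  proof (induction N)
    case (Suc N)
    have "(\<Sum>j<Suc N. a j * vil_M m j) < (a N + 1) * vil_M m N" using Suc by simp
    also have "\<dots> \<le> m N * vil_M m N" using less[of N] by (intro mult_right_mono) simp_all
    finally show ?case by simp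
  qed simp
  have digit: "vil_digit m (\<Sum>j<N. a j * vil_M m j) i = a i" if "i < N" for N i
    using that
  proof (induction N)
    case (Suc N)
    show ?case
    proof (cases "i = N")
      case True
      then show ?thesis using bound[of N] less[of N] Mpos[of N] by (simp add: vil_digit_def)
    next
      case False
      then have i: "Suc i \<le> N" using Suc by simp
      have "vil_M m (Suc i) dvd vil_M m N"
        using i by (induction N rule: dec_induct) simp_all
      then obtain c where c: "vil_M m N = vil_M m i * (m i * c)"
        by (metis dvdE mult.assoc mult.commute vil_M.simps(2))
      have "(\<Sum>j<Suc N. a j * vil_M m j) div vil_M m i
          = ((\<Sum>j<N. a j * vil_M m j) + a N * (m i * c) * vil_M m i) div vil_M m i"
        by (simp add: c mult_ac)
      also have "\<dots> = (\<Sum>j<N. a j * vil_M m j) div vil_M m i + m i * (a N * c)"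
        using Mpos[of i] by (subst div_mult_self1) (simp_all add: mult_ac)
      finally have "vil_digit m (\<Sum>j<Suc N. a j * vil_M m j) i
          = vil_digit m (\<Sum>j<N. a j * vil_M m j) i"
        by (simp add: vil_digit_def)
      then show ?thesis using Suc i by simp
    qed
  qed simp
  obtain N0 where "\<forall>j\<in>{j. a j \<noteq> 0}. j < N0"
    using fin finite_nat_set_iff_bounded by blast
  then have "(\<Sum>j | a j \<noteq> 0. a j * vil_M m j) = (\<Sum>j<max N0 (Suc j). a j * vil_M m j)"
    by (intro sum.mono_neutral_left) (auto simp: less_max_iff_disj)
  then show ?thesis using n digit[of j "max N0 (Suc j)"] by simp
qed

section \<open>The Vilenkin group and the Vilenkin system\<close>

definition vil_measure :: "(nat \<Rightarrow> nat) \<Rightarrow> (nat \<Rightarrow> nat) measure" where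
  "vil_measure m = PiM UNIV (\<lambda>k. uniform_count_measure {0..<m k})"

definition vil_I :: "(nat \<Rightarrow> nat) \<Rightarrow> nat \<Rightarrow> (nat \<Rightarrow> nat) \<Rightarrow> (nat \<Rightarrow> nat) set" where
  "vil_I m n x = {y \<in> space (vil_measure m). \<forall>j<n. y j = x j}"

text \<open>A sub-\<open>\<sigma>\<close>-algebra is represented by a measure whose measure part is irrelevant.\<close>

definition vil_F :: "(nat \<Rightarrow> nat) \<Rightarrow> nat \<Rightarrow> (nat \<Rightarrow> nat) measure" where
  "vil_F m n = sigma (space (vil_measure m)) (vil_I m n ` space (vil_measure m))"

definition vil_r :: "(nat \<Rightarrow> nat) \<Rightarrow> nat \<Rightarrow> (nat \<Rightarrow> nat) \<Rightarrow> complex" where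
  "vil_r m k x = exp (2 * of_real pi * \<i> * of_nat (x k) / of_nat (m k))"

text \<open>The factors outside \<open>vil_supp m n\<close> are all equal to 1.\<close>

definition vil_psi :: "(nat \<Rightarrow> nat) \<Rightarrow> nat \<Rightarrow> (nat \<Rightarrow> nat) \<Rightarrow> complex" where
  "vil_psi m n x = (\<Prod>k\<in>vil_supp m n. vil_r m k x ^ vil_digit m n k)"

section \<open>Martingales, Fourier coefficients and partial sums\<close>

definition complex_cond_exp ::
    "'a measure \<Rightarrow> 'a measure \<Rightarrow> ('a \<Rightarrow> complex) \<Rightarrow> 'a \<Rightarrow> complex" where
  "complex_cond_exp M F f x =
     Complex (real_cond_exp M F (\<lambda>y. Re (f y)) x) (real_cond_exp M F (\<lambda>y. Im (f y)) x)"

definition vil_martingale :: "(nat \<Rightarrow> nat) \<Rightarrow> (nat \<Rightarrow> (nat \<Rightarrow> nat) \<Rightarrow> complex) \<Rightarrow> bool" where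
  "vil_martingale m f \<longleftrightarrow>
     (\<forall>n. f n \<in> borel_measurable (vil_F m n)) \<and>
     (\<forall>n. integrable (vil_measure m) (f n)) \<and>
     (\<forall>n k. n \<le> k \<longrightarrow>
        (AE x in vil_measure m. complex_cond_exp (vil_measure m) (vil_F m n) (f k) x = f n x))"

definition vil_coeff :: "(nat \<Rightarrow> nat) \<Rightarrow> (nat \<Rightarrow> (nat \<Rightarrow> nat) \<Rightarrow> complex) \<Rightarrow> nat \<Rightarrow> complex" where
  "vil_coeff m f i = lim (\<lambda>k. \<integral>x. f k x * cnj (vil_psi m i x) \<partial>vil_measure m)"

definition vil_S ::
    "(nat \<Rightarrow> nat) \<Rightarrow> nat \<Rightarrow> (nat \<Rightarrow> (nat \<Rightarrow> nat) \<Rightarrow> complex) \<Rightarrow> (nat \<Rightarrow> nat) \<Rightarrow> complex" where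
  "vil_S m n f x = (\<Sum>k<n. vil_coeff m f k * vil_psi m k x)"

text \<open>
  The same notions for an integrable function \<open>g\<close>, and the martingale \<open>(S\<^bsub>M\<^sub>n\<^esub> g)\<^sub>n\<close> with which
  \<open>g\<close> is identified.
\<close>

definition vil_fun_coeff :: "(nat \<Rightarrow> nat) \<Rightarrow> ((nat \<Rightarrow> nat) \<Rightarrow> complex) \<Rightarrow> nat \<Rightarrow> complex" where
  "vil_fun_coeff m g i = (\<integral>x. g x * cnj (vil_psi m i x) \<partial>vil_measure m)"

definition vil_fun_S ::
    "(nat \<Rightarrow> nat) \<Rightarrow> nat \<Rightarrow> ((nat \<Rightarrow> nat) \<Rightarrow> complex) \<Rightarrow> (nat \<Rightarrow> nat) \<Rightarrow> complex" where
  "vil_fun_S m n g x = (\<Sum>k<n. vil_fun_coeff m g k * vil_psi m k x)"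

definition vil_mart_of ::
    "(nat \<Rightarrow> nat) \<Rightarrow> ((nat \<Rightarrow> nat) \<Rightarrow> complex) \<Rightarrow> nat \<Rightarrow> (nat \<Rightarrow> nat) \<Rightarrow> complex" where
  "vil_mart_of m g = (\<lambda>n. vil_fun_S m (vil_M m n) g)"

section \<open>Hardy spaces and weak Lebesgue spaces\<close>

text \<open>
  The maximal function and the (quasi-)norms may be infinite, so they take values in \<open>[0, \<infinity>]\<close>.
  The power \<open>x\<^sup>p\<close> on \<open>[0, \<infinity>]\<close> is only meant for \<open>p > 0\<close>.
\<close>

definition ennreal_rpow :: "ennreal \<Rightarrow> real \<Rightarrow> ennreal" where
  "ennreal_rpow x p = (if x = \<infinity> then \<infinity> else ennreal (enn2real x powr p))"

definition max_fun :: "(nat \<Rightarrow> 'a \<Rightarrow> complex) \<Rightarrow> 'a \<Rightarrow> ennreal" where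
  "max_fun f x = (SUP n. ennreal (norm (f n x)))"

definition Hp_norm :: "(nat \<Rightarrow> nat) \<Rightarrow> real \<Rightarrow> (nat \<Rightarrow> (nat \<Rightarrow> nat) \<Rightarrow> complex) \<Rightarrow> ennreal" where
  "Hp_norm m p f =
     ennreal_rpow (\<integral>\<^sup>+x. ennreal_rpow (max_fun f x) p \<partial>vil_measure m) (1 / p)"

definition Hp_space :: "(nat \<Rightarrow> nat) \<Rightarrow> real \<Rightarrow> (nat \<Rightarrow> (nat \<Rightarrow> nat) \<Rightarrow> complex) set" where
  "Hp_space m p = {f. vil_martingale m f \<and> Hp_norm m p f < \<infinity>}"

definition weak_Lp_norm :: "'a measure \<Rightarrow> real \<Rightarrow> ('a \<Rightarrow> complex) \<Rightarrow> ennreal" where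
  "weak_Lp_norm M p g =
     (SUP l\<in>{0::real<..}.
        ennreal l * ennreal_rpow (emeasure M {x \<in> space M. l < norm (g x)}) (1 / p))"

end

theory Submission
  imports Defs
begin

text \<open>
  Everything rests on the Dirichlet kernel \<open>D\<^sub>n = \<Sum>\<^bsub>k<n\<^esub> \<psi>\<^sub>k\<close>. On \<open>I\<^sub>s(0) - I\<^bsub>s+1\<^esub>(0)\<close> the sum of \<open>\<psi>\<^sub>k\<close>
  over a full block \<open>{a M\<^bsub>s+1\<^esub>..<(a+1) M\<^bsub>s+1\<^esub>}\<close> is 0 (\<open>kern_M\<close>), so \<open>|D\<^sub>n|\<close> only depends on the
  remainder of \<open>n\<close> modulo \<open>M\<^bsub>s+1\<^esub>\<close> (\<open>norm_kern_mod\<close>): it is 0 for \<open>s < \<langle>n\<rangle>\<close> and at most \<open>M\<^bsub>s+1\<^esub>\<close>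
  in general. Since \<open>I\<^sub>s(0)\<close> has measure \<open>1 / M\<^sub>s\<close> and \<open>m\<close> is bounded, \<open>\<integral>|D\<^sub>n|\<^sup>p\<close> is at most a
  constant times the geometric sum of the \<open>M\<^sub>s\<^bsup>p-1\<^esup>\<close> over \<open>s \<ge> \<langle>n\<rangle>\<close>, that is, a constant times
  \<open>M\<^bsub>\<langle>n\<rangle>\<^esub>\<^bsup>p-1\<^esup>\<close> (\<open>nn_integral_kern_powr_le\<close>).

  Upper estimate. With \<open>N = |n| + 1\<close>, the function \<open>S\<^sub>n f\<close> is the convolution of \<open>f\<^sub>N\<close> with \<open>D\<^sub>n\<close>, and
  both are constant on the \<open>M\<^sub>N\<close> cells of level \<open>N\<close>; it is an average over \<open>M\<^sub>N\<close> terms. The inequality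
  \<open>(\<Sum> a\<^sub>u)\<^sup>p \<le> \<Sum> a\<^sub>u\<^sup>p\<close> yields \<open>\<integral>|S\<^sub>n f|\<^sup>p \<le> M\<^sub>N\<^bsup>1-p\<^esup> \<integral>|D\<^sub>n|\<^sup>p \<integral>|f\<^sub>N|\<^sup>p\<close>, which is the claim
  for the \<open>L\<^sub>p\<close>-norm of \<open>S\<^sub>n f\<close> (\<open>nn_integral_vil_S_powr_le\<close>). As \<open>S\<^bsub>M\<^sub>k\<^esub> S\<^sub>n f\<close> is either \<open>f\<^sub>k\<close> or
  \<open>S\<^sub>n f\<close>, the maximal function of \<open>S\<^sub>n f\<close> is at most the larger of \<open>|S\<^sub>n f|\<close> and the maximal
  function of \<open>f\<close> (\<open>Hp_norm_vil_S_le\<close>).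

  Sharpness. Let \<open>f\<close> have the constant Fourier coefficient \<open>\<beta> a M\<^sub>a\<^bsup>1/p-1\<^esup>\<close> on the block
  \<open>{M\<^sub>a..<M\<^bsub>a+1\<^esub>}\<close>, where \<open>0 \<le> \<beta> a \<le> 1\<close>. It belongs to \<open>H\<^sub>p\<close> as soon as \<open>\<Sum>\<^sub>a (\<beta> a)\<^sup>p\<close> is finite
  (\<open>block_martingale_in_Hp\<close>). On the cell of the \<open>x\<close> with \<open>x\<^sub>j = 0\<close> for \<open>j < L = \<langle>n\<rangle>\<close> and \<open>x\<^sub>L = 1\<close>,
  one has \<open>|D\<^sub>n| \<ge> M\<^sub>L\<close> (\<open>norm_kern_ge\<close>), whereas \<open>|f\<^bsub>|n|\<^esub>| \<le> 2 B M\<^sub>L\<^bsup>1/p\<^esup>\<close> with \<open>B\<close> an upper bound of \<open>m\<close>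
  (\<open>norm_block_martingale_le_cell\<close>). If \<open>\<beta> |n| (M\<^bsub>|n|\<^esub> / M\<^sub>L)\<^bsup>1/p-1\<^esup>\<close> is at least \<open>4 B\<close>, the new block
  dominates and the weak norm of \<open>S\<^sub>n f\<close> is at least a constant times this quantity
  (\<open>weak_norm_vil_S_ge\<close>). Putting the weight \<open>2\<^sup>-\<^sup>i\<close> on levels along which the ratio in the hypothesis
  grows like \<open>4\<^sup>i\<close> finishes the proof (\<open>exists_divergent_martingale\<close>).
\<close>

section \<open>Digits and the Vilenkin system\<close>

text \<open>The generating sequence \<open>m\<close>, not yet assumed to be bounded.\<close>

locale vilenkin =
  fixes m :: "nat \<Rightarrow> nat"
  assumes ge2: "2 \<le> m k"
begin

lemma m_pos: "0 < m k"
  using ge2[of k] by simp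

lemma M_pos: "0 < vil_M m k"
  using m_pos by (induction k) simp_all

lemma M_nonzero: "vil_M m k \<noteq> 0"
  using M_pos[of k] by simp

lemma M_gt: "k < vil_M m k"
  by (rule vil_M_gt) (rule ge2)

lemma M_factor:
  assumes "i \<le> j"
  obtains c where "vil_M m j = vil_M m i * c" "0 < c"
proof -
  have "vil_M m i dvd vil_M m j"
    using assms by (induction j rule: dec_induct) simp_all
  then show ?thesis
    using that M_pos[of j] by (metis dvdE mult_eq_0_iff neq0_conv)
qed

lemma M_mono: "i \<le> j \<Longrightarrow> vil_M m i \<le> vil_M m j"
  by (metis M_factor M_pos Suc_leI mult.right_neutral mult_le_mono2 One_nat_def)

lemma M_Suc_ge: "2 * vil_M m k \<le> vil_M m (Suc k)"
  using ge2[of k] by simp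

lemma digit_less: "vil_digit m n j < m j"
  by (rule vil_digit_less) (rule ge2)

lemma digit_zero: "n < vil_M m N \<Longrightarrow> N \<le> j \<Longrightarrow> vil_digit m n j = 0"
  using M_mono[of N j] by (simp add: vil_digit_def)

lemma digit_add_low:
  assumes "j < N"
  shows "vil_digit m (a * vil_M m N + b) j = vil_digit m b j"
proof -
  obtain c where c: "vil_M m N = vil_M m (Suc j) * c"
    using M_factor[of "Suc j" N] assms by auto
  have "(a * vil_M m N + b) div vil_M m j = (b + (a * c * m j) * vil_M m j) div vil_M m j"
    by (simp add: c mult_ac add.commute)
  also have "\<dots> = a * c * m j + b div vil_M m j"
    using M_pos[of j] by (subst div_mult_self1) simp_all
  finally show ?thesis
    by (simp add: vil_digit_def)
qed

lemma digit_add_high: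
  assumes "N \<le> j" "b < vil_M m N"
  shows "vil_digit m (a * vil_M m N + b) j = vil_digit m (a * vil_M m N) j"
proof -
  obtain c where c: "vil_M m j = vil_M m N * c"
    using M_factor[of N j] assms by auto
  show ?thesis
    using assms(2) M_pos[of N] by (simp add: vil_digit_def c div_mult2_eq)
qed

lemma digit_single:
  assumes "d < m N"
  shows "vil_digit m (d * vil_M m N) j = (if j = N then d else 0)"
proof -
  consider "j < N" | "j = N" | "N < j" by linarith
  then show ?thesis
  proof cases
    case 1
    then show ?thesis
      using digit_add_low[of j N d 0] by (simp add: vil_digit_def)
  next
    case 2
    then show ?thesis
      using assms M_pos[of N] by (simp add: vil_digit_def)
  next
    case 3
    have "d * vil_M m N < vil_M m (Suc N)"
      using assms M_pos[of N] by simp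
    then show ?thesis
      using 3 digit_zero[of _ "Suc N" j] by simp
  qed
qed

lemma digit_inj:
  assumes "u < vil_M m N" "v < vil_M m N" "\<And>j. j < N \<Longrightarrow> vil_digit m u j = vil_digit m v j"
  shows "u = v"
proof -
  have "(\<Sum>j<N. vil_digit m u j * vil_M m j) = (\<Sum>j<N. vil_digit m v j * vil_M m j)"
    using assms(3) by simp
  then show ?thesis
    unfolding vil_digit_sum_mod using assms(1,2) by simp
qed

lemma digit_surj:
  assumes "\<And>j. x j < m j"
  shows "\<exists>u<vil_M m N. \<forall>j<N. vil_digit m u j = x j"
proof (induction N)
  case (Suc N)
  then obtain u where u: "u < vil_M m N" "\<And>j. j < N \<Longrightarrow> vil_digit m u j = x j" by auto
  let ?v = "x N * vil_M m N + u"
  have "?v < (x N + 1) * vil_M m N"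
    using u by simp
  also have "\<dots> \<le> m N * vil_M m N"
    using assms[of N] by (intro mult_right_mono) simp_all
  finally have "?v < vil_M m (Suc N)" by simp
  moreover have "vil_digit m ?v j = x j" if "j < Suc N" for j
    using that u digit_add_low[of j N "x N" u] digit_add_high[of N j u "x N"]
      digit_single[of "x N" N j] assms[of N]
    by (cases "j = N") simp_all
  ultimately show ?case by blast
qed simp

lemma supp_finite: "finite (vil_supp m n)"
  by (rule finite_vil_supp) (rule ge2)

lemma supp_nonempty:
  assumes "0 < n" shows "vil_supp m n \<noteq> {}"
proof
  assume "vil_supp m n = {}"
  then have "(\<Sum>j\<in>vil_supp m n. vil_digit m n j * vil_M m j) = 0" by simp
  with vil_digit_expansion[OF ge2] have "n = 0" by (rule trans)
  with assms show False by simp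
qed

lemma high_bounds:
  assumes "0 < n"
  shows "vil_M m (vil_high m n) \<le> n" "n < vil_M m (Suc (vil_high m n))"
proof -
  let ?h = "vil_high m n"
  have "?h \<in> vil_supp m n"
    unfolding vil_high_def using supp_finite supp_nonempty[OF assms] by (rule Max_in)
  then show "vil_M m ?h \<le> n"
    using digit_zero[of n ?h ?h] by (auto simp: vil_supp_def not_less[symmetric])
  have zero: "vil_digit m n j = 0" if "Suc ?h \<le> j" for j
    using that supp_finite[of n] Max_ge[of "vil_supp m n" j] unfolding vil_high_def vil_supp_def
    by fastforce
  have "n = (\<Sum>j<Suc ?h + n. vil_digit m n j * vil_M m j)"
    using vil_digit_sum_mod[of m n "Suc ?h + n"] M_gt[of "Suc ?h + n"] by simp
  also have "\<dots> = (\<Sum>j<Suc ?h. vil_digit m n j * vil_M m j)"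
    using zero by (intro sum.mono_neutral_right) (auto simp: not_less)
  also have "\<dots> < vil_M m (Suc ?h)"
    using vil_digit_sum_mod[of m n "Suc ?h"] M_pos[of "Suc ?h"] by simp
  finally show "n < vil_M m (Suc ?h)" .
qed

lemma high_unique:
  assumes "vil_M m N \<le> n" "n < vil_M m (Suc N)"
  shows "vil_high m n = N"
proof -
  have n: "0 < n" using assms M_pos[of N] by simp
  show ?thesis
    using high_bounds[OF n] assms M_mono[of "Suc N" "vil_high m n"] M_mono[of "Suc (vil_high m n)" N]
    by (metis leD le_less_trans less_le_trans linorder_neqE_nat Suc_leI)
qed

lemma low_le_high:
  assumes "0 < n" shows "vil_low m n \<le> vil_high m n"
  unfolding vil_low_def vil_high_def
  using supp_finite supp_nonempty[OF assms] by (meson Max_ge Min_in)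

text \<open>All digits below \<open>vil_low m n\<close> vanish, so the corresponding remainders do.\<close>

lemma mod_low:
  assumes "s \<le> vil_low m n"
  shows "n mod vil_M m s = 0"
proof -
  have "vil_digit m n j = 0" if "j < s" for j
    using that assms supp_finite[of n] Min_le[of "vil_supp m n" j] unfolding vil_low_def vil_supp_def
    by fastforce
  then show ?thesis
    using vil_digit_sum_mod[of m n s] by simp
qed

lemma mod_Suc_low:
  assumes "0 < n"
  obtains d where "n mod vil_M m (Suc (vil_low m n)) = d * vil_M m (vil_low m n)"
    "0 < d" "d < m (vil_low m n)"
proof -
  let ?l = "vil_low m n"
  have "?l \<in> vil_supp m n"
    unfolding vil_low_def using supp_finite supp_nonempty[OF assms] by (rule Min_in)
  moreover have "n mod vil_M m (Suc ?l) = vil_digit m n ?l * vil_M m ?l"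
    using vil_digit_sum_mod[of m n "Suc ?l"] vil_digit_sum_mod[of m n ?l] mod_low[of ?l n] by simp
  ultimately show ?thesis
    by (intro that[of "vil_digit m n ?l"]) (simp_all add: vil_supp_def digit_less)
qed

text \<open>Since \<open>n < M\<^sub>N\<close> has no digits from position \<open>N\<close> on, \<open>\<psi>\<^sub>n\<close> only sees \<open>x\<^sub>0, \<dots>, x\<^bsub>N-1\<^esub>\<close>.\<close>

lemma psi_eq_prod:
  assumes "n < vil_M m N"
  shows "vil_psi m n x = (\<Prod>j<N. vil_r m j x ^ vil_digit m n j)"
  unfolding vil_psi_def using digit_zero[OF assms]
  by (intro prod.mono_neutral_left) (force simp: vil_supp_def not_less[symmetric])+

lemma psi_cong:
  assumes "n < vil_M m N" "\<And>j. j < N \<Longrightarrow> x j = y j"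
  shows "vil_psi m n x = vil_psi m n y"
  using assms by (simp add: psi_eq_prod vil_r_def)

lemma norm_r [simp]: "norm (vil_r m j x) = 1"
proof -
  have "vil_r m j x = exp (\<i> * of_real (2 * pi * real (x j) / real (m j)))"
    by (simp add: vil_r_def mult_ac)
  then show ?thesis by (simp only: norm_exp_i_times)
qed

lemma norm_psi [simp]: "norm (vil_psi m n x) = 1"
  by (simp add: vil_psi_def prod_norm[symmetric] norm_power)

lemma psi_zero [simp]: "vil_psi m 0 x = 1"
  using psi_eq_prod[of 0 0 x] by simp

lemma psi_add:
  assumes "b < vil_M m N"
  shows "vil_psi m (a * vil_M m N + b) x = vil_psi m (a * vil_M m N) x * vil_psi m b x"
proof -
  define L where "L = a * vil_M m N + b"
  have L: "a * vil_M m N + b < vil_M m L" "a * vil_M m N < vil_M m L" "b < vil_M m L"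
    using M_gt[of L] by (simp_all add: L_def)
  have "vil_digit m (a * vil_M m N + b) j = vil_digit m (a * vil_M m N) j + vil_digit m b j" for j
    using digit_add_low[of j N a b] digit_add_low[of j N a 0] digit_add_high[of N j b a]
      digit_zero[OF assms, of j] assms
    by (cases "j < N") (simp_all add: vil_digit_def[of m 0])
  then show ?thesis
    by (simp add: L psi_eq_prod[OF L(1)] psi_eq_prod[OF L(2)] psi_eq_prod[OF L(3)] power_add
        prod.distrib)
qed

lemma psi_single:
  assumes "d < m N"
  shows "vil_psi m (d * vil_M m N) x = vil_r m N x ^ d"
proof -
  have "vil_supp m (d * vil_M m N) \<subseteq> {N}"
    using digit_single[OF assms] by (auto simp: vil_supp_def split: if_splits)
  then have "vil_psi m (d * vil_M m N) x = (\<Prod>k\<in>{N}. vil_r m k x ^ vil_digit m (d * vil_M m N) k)"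
    unfolding vil_psi_def by (intro prod.mono_neutral_left) (auto simp: vil_supp_def intro!: gr0I)
  then show ?thesis
    using digit_single[OF assms] by simp
qed

text \<open>
  \<open>vil_digit m u\<close> is itself a point of the group. With such points the system is symmetric in
  the index and the variable.
\<close>

lemma psi_symmetric:
  assumes "u < vil_M m N" "k < vil_M m N"
  shows "vil_psi m k (vil_digit m u) = vil_psi m u (vil_digit m k)"
  using assms
  by (simp add: psi_eq_prod vil_r_def exp_of_nat_mult[symmetric] mult_ac)

section \<open>The Dirichlet kernel\<close>

text \<open>The two-variable form \<open>D\<^sub>n(x - t)\<close> of the Dirichlet kernel, without the group operation.\<close>

definition kern :: "nat \<Rightarrow> (nat \<Rightarrow> nat) \<Rightarrow> (nat \<Rightarrow> nat) \<Rightarrow> complex" where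
  "kern n x t = (\<Sum>k<n. vil_psi m k x * cnj (vil_psi m k t))"

lemma norm_kern_le: "norm (kern n x t) \<le> real n"
proof -
  have "norm (kern n x t) \<le> (\<Sum>k<n. norm (vil_psi m k x * cnj (vil_psi m k t)))"
    unfolding kern_def by (rule norm_sum)
  then show ?thesis by (simp add: norm_mult)
qed

lemma kern_add:
  assumes "b \<le> vil_M m N"
  shows "kern (a * vil_M m N + b) x t = kern (a * vil_M m N) x t
    + vil_psi m (a * vil_M m N) x * cnj (vil_psi m (a * vil_M m N) t) * kern b x t"
proof -
  let ?g = "\<lambda>k. vil_psi m k x * cnj (vil_psi m k t)" and ?A = "a * vil_M m N"
  have "kern (?A + b) x t = kern ?A x t + (\<Sum>k<b. ?g (?A + k))"
    unfolding kern_def by (induction b) (simp_all add: add.assoc)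
  also have "(\<Sum>k<b. ?g (?A + k)) = (\<Sum>k<b. ?g ?A * ?g k)"
    using assms by (intro sum.cong refl) (simp add: psi_add mult_ac)
  also have "\<dots> = ?g ?A * kern b x t"
    by (simp add: kern_def sum_distrib_left)
  finally show ?thesis .
qed

lemma kern_mult:
  "kern (a * vil_M m N) x t
    = (\<Sum>e<a. vil_psi m (e * vil_M m N) x * cnj (vil_psi m (e * vil_M m N) t)) * kern (vil_M m N) x t"
proof (induction a)
  case (Suc a)
  have "Suc a * vil_M m N = a * vil_M m N + vil_M m N" by simp
  then show ?case
    using kern_add[of "vil_M m N" N a x t] Suc by (simp add: algebra_simps)
qed (simp add: kern_def)

lemma r_ratio:
  "(vil_r m j x * cnj (vil_r m j t)) ^ m j = 1"
  "x j < m j \<Longrightarrow> t j < m j \<Longrightarrow> vil_r m j x * cnj (vil_r m j t) = 1 \<longleftrightarrow> x j = t j"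
proof -
  have root: "vil_r m j y ^ m j = 1" for y
    unfolding vil_r_def using m_pos[of j] by (intro complex_root_unity) simp
  show "(vil_r m j x * cnj (vil_r m j t)) ^ m j = 1"
    using root[of x] root[of t] by (simp add: power_mult_distrib flip: complex_cnj_power)
  assume "x j < m j" "t j < m j"
  moreover have "vil_r m j t * cnj (vil_r m j t) = 1"
    by (simp add: complex_norm_square[symmetric])
  then have "vil_r m j x * cnj (vil_r m j t) = 1 \<longleftrightarrow> vil_r m j x = vil_r m j t"
    by (metis mult.commute mult.left_commute mult.right_neutral)
  moreover have "vil_r m j x = vil_r m j t \<longleftrightarrow> x j mod m j = t j mod m j"
    unfolding vil_r_def using m_pos[of j] by (intro complex_root_unity_eq) simp
  ultimately show "vil_r m j x * cnj (vil_r m j t) = 1 \<longleftrightarrow> x j = t j" by simp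
qed

lemma kern_single:
  assumes "d \<le> m N"
  shows "kern (d * vil_M m N) x t
    = (\<Sum>e<d. (vil_r m N x * cnj (vil_r m N t)) ^ e) * kern (vil_M m N) x t"
  unfolding kern_mult[of d] using assms
  by (intro arg_cong2[where f = "(*)"] sum.cong refl) (simp add: psi_single power_mult_distrib)

lemma kern_M:
  assumes "\<And>j. x j < m j" "\<And>j. t j < m j"
  shows "kern (vil_M m N) x t = (if \<forall>j<N. x j = t j then of_nat (vil_M m N) else 0)"
proof (induction N)
  case 0
  then show ?case by (simp add: kern_def)
next
  case (Suc N)
  let ?q = "vil_r m N x * cnj (vil_r m N t)"
  have "kern (vil_M m (Suc N)) x t = (\<Sum>e<m N. ?q ^ e) * kern (vil_M m N) x t"
    using kern_single[of "m N" N x t] by simp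
  also have "(\<Sum>e<m N. ?q ^ e) = (if x N = t N then of_nat (m N) else 0)"
  proof (cases "x N = t N")
    case True
    then have "?q = 1" using r_ratio(2)[of x N t] assms by simp
    then show ?thesis using True by simp
  next
    case False
    then have "?q \<noteq> 1" using r_ratio(2)[of x N t] assms by simp
    then show ?thesis using False r_ratio(1)[of N x t] by (simp add: geometric_sum)
  qed
  finally show ?case
    using Suc by (auto simp: less_Suc_eq)
qed

text \<open>
  If \<open>x\<close> and \<open>t\<close> differ at position \<open>s\<close>, full blocks of length \<open>M\<^bsub>s+1\<^esub>\<close> cancel in the kernel
  and only the remainder modulo \<open>M\<^bsub>s+1\<^esub>\<close> is left.
\<close>

lemma norm_kern_mod:
  assumes "\<And>j. x j < m j" "\<And>j. t j < m j" "x s \<noteq> t s"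
  shows "norm (kern n x t) = norm (kern (n mod vil_M m (Suc s)) x t)"
proof -
  let ?M = "vil_M m (Suc s)" and ?a = "n div vil_M m (Suc s)" and ?b = "n mod vil_M m (Suc s)"
  have "kern ?M x t = 0"
    using kern_M[OF assms(1,2), of "Suc s"] assms(3) by auto
  then have "kern (?a * ?M) x t = 0" by (subst kern_mult) simp
  moreover have "?b \<le> ?M"
    using M_pos[of "Suc s"] by (intro less_imp_le mod_less_divisor)
  ultimately have "kern (?a * ?M + ?b) x t
      = vil_psi m (?a * ?M) x * cnj (vil_psi m (?a * ?M) t) * kern ?b x t"
    by (subst kern_add) simp_all
  then show ?thesis
    by (simp only: div_mult_mod_eq norm_mult complex_mod_cnj norm_psi)
qed

lemma norm_kern_less:
  assumes "\<And>j. x j < m j" "\<And>j. t j < m j" "x s \<noteq> t s"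
  shows "norm (kern n x t) \<le> real (vil_M m (Suc s))"
proof -
  have "n mod vil_M m (Suc s) \<le> vil_M m (Suc s)"
    using M_pos[of "Suc s"] by (intro less_imp_le mod_less_divisor)
  then show ?thesis
    using norm_kern_mod[OF assms, of n] norm_kern_le[of "n mod vil_M m (Suc s)" x t]
    by (metis of_nat_mono order.trans)
qed

lemma kern_below_low:
  assumes "\<And>j. x j < m j" "\<And>j. t j < m j" "x s \<noteq> t s" "s < vil_low m n"
  shows "kern n x t = 0"
proof -
  have "norm (kern n x t) = norm (kern 0 x t)"
    using norm_kern_mod[OF assms(1-3), of n] mod_low[of "Suc s" n] assms(4) by simp
  then show ?thesis by (simp add: kern_def)
qed

section \<open>Cells and functions of finitely many coordinates\<close>

sublocale prob_space "vil_measure m"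
  unfolding vil_measure_def using m_pos
  by (intro prob_space_PiM prob_space_uniform_count_measure) auto

lemma space_iff: "x \<in> space (vil_measure m) \<longleftrightarrow> (\<forall>j. x j < m j)"
  by (auto simp: vil_measure_def space_PiM space_uniform_count_measure PiE_iff)

lemma digit_in_space [simp]: "vil_digit m u \<in> space (vil_measure m)"
  by (simp add: space_iff digit_less)

lemma vil_I_eq_emb:
  "vil_I m N x = prod_emb UNIV (\<lambda>k. uniform_count_measure {0..<m k}) {..<N} (\<Pi>\<^sub>E j\<in>{..<N}. {x j})"
  by (auto simp: vil_I_def prod_emb_def space_iff PiE_iff space_uniform_count_measure)

lemma emeasure_vil_I:
  assumes "x \<in> space (vil_measure m)"
  shows "emeasure (vil_measure m) (vil_I m N x) = ennreal (1 / real (vil_M m N))"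
proof -
  have x: "x j < m j" for j using assms by (simp add: space_iff)
  have "emeasure (vil_measure m) (vil_I m N x)
      = (\<Prod>j<N. emeasure (uniform_count_measure {0..<m j}) {x j})"
    unfolding vil_measure_def vil_I_eq_emb using x m_pos
    by (intro emeasure_PiM_emb prob_space_uniform_count_measure) (auto simp: sets_uniform_count_measure)
  also have "\<dots> = (\<Prod>j<N. ennreal (1 / real (m j)))"
    using x by (intro prod.cong refl)
      (subst emeasure_uniform_count_measure,
        auto simp: divide_ennreal[symmetric] m_pos ennreal_of_nat_eq_real_of_nat)
  also have "\<dots> = ennreal (\<Prod>j<N. 1 / real (m j))"
    by (intro prod_ennreal) simp
  also have "(\<Prod>j<N. 1 / real (m j)) = 1 / real (vil_M m N)"
    by (induction N) simp_all
  finally show ?thesis .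
qed

lemma vil_I_sets [measurable, simp]: "vil_I m N x \<in> sets (vil_measure m)"
proof (cases "\<forall>j<N. x j < m j")
  case True
  then show ?thesis
    unfolding vil_I_eq_emb vil_measure_def
    by (intro sets_PiM_I) (auto simp: sets_uniform_count_measure)
next
  case False
  then have "vil_I m N x = {}"
    by (auto simp: vil_I_def space_iff) metis
  then show ?thesis by simp
qed

lemma measure_vil_I:
  "x \<in> space (vil_measure m) \<Longrightarrow> measure (vil_measure m) (vil_I m N x) = 1 / real (vil_M m N)"
  by (simp add: measure_def emeasure_vil_I)

text \<open>
  The cells of level \<open>N\<close>, enumerated by \<open>u < M\<^sub>N\<close>: the first \<open>N\<close> coordinates are the digits of \<open>u\<close>.
  The point \<open>vil_digit m u\<close> serves as the representative of its cell.
\<close>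

abbreviation cell :: "nat \<Rightarrow> nat \<Rightarrow> (nat \<Rightarrow> nat) set" where
  "cell N u \<equiv> vil_I m N (vil_digit m u)"

lemma cell_unique:
  assumes "x \<in> space (vil_measure m)"
  obtains u where "u < vil_M m N" "\<And>j. j < N \<Longrightarrow> vil_digit m u j = x j"
    "\<And>v. v < vil_M m N \<Longrightarrow> x \<in> cell N v \<longleftrightarrow> v = u"
proof -
  obtain u where u: "u < vil_M m N" "\<And>j. j < N \<Longrightarrow> vil_digit m u j = x j"
    using digit_surj[of x N] assms by (auto simp: space_iff)
  moreover have "x \<in> cell N v \<longleftrightarrow> v = u" if "v < vil_M m N" for v
    using that assms u digit_inj[of v N u] by (auto simp: vil_I_def)
  ultimately show ?thesis using that by blast
qed

text \<open>\<open>h\<close> only depends, on the group, on the first \<open>N\<close> coordinates.\<close>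

definition depends_on :: "nat \<Rightarrow> ((nat \<Rightarrow> nat) \<Rightarrow> 'b) \<Rightarrow> bool" where
  "depends_on N h \<longleftrightarrow> (\<forall>x\<in>space (vil_measure m). \<forall>y\<in>space (vil_measure m).
     (\<forall>j<N. x j = y j) \<longrightarrow> h x = h y)"

lemma depends_onD:
  "depends_on N h \<Longrightarrow> x \<in> space (vil_measure m) \<Longrightarrow> y \<in> space (vil_measure m) \<Longrightarrow>
    (\<And>j. j < N \<Longrightarrow> x j = y j) \<Longrightarrow> h x = h y"
  unfolding depends_on_def by blast

lemma depends_on_psi: "k < vil_M m N \<Longrightarrow> depends_on N (vil_psi m k)"
  unfolding depends_on_def by (blast intro: psi_cong)

lemma depends_on_comp: "depends_on N h \<Longrightarrow> depends_on N (\<lambda>x. g (h x))"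
  unfolding depends_on_def by metis

lemma depends_on_cell: "x \<in> vil_I m N y \<Longrightarrow> y \<in> space (vil_measure m) \<Longrightarrow> depends_on N h \<Longrightarrow> h x = h y"
  unfolding depends_on_def vil_I_def by blast

lemma depends_on_expand:
  fixes h :: "_ \<Rightarrow> 'b::semiring_1"
  assumes "depends_on N h" "x \<in> space (vil_measure m)"
  shows "h x = (\<Sum>u<vil_M m N. h (vil_digit m u) * indicator (cell N u) x)"
proof -
  obtain u where u: "u < vil_M m N" "\<And>j. j < N \<Longrightarrow> vil_digit m u j = x j"
    "\<And>v. v < vil_M m N \<Longrightarrow> x \<in> cell N v \<longleftrightarrow> v = u"
    using cell_unique[OF assms(2)] by metis
  have "(\<Sum>v<vil_M m N. h (vil_digit m v) * indicator (cell N v) x)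
      = (\<Sum>v<vil_M m N. if v = u then h (vil_digit m v) else 0)"
    using u by (intro sum.cong refl) (simp add: indicator_def)
  also have "\<dots> = h (vil_digit m u)"
    using u by simp
  also have "\<dots> = h x"
    using assms u(2) by (intro depends_onD[OF assms(1)]) auto
  finally show ?thesis by simp
qed

lemma sets_vil_F: "sets (vil_F m N) = sigma_sets (space (vil_measure m)) (vil_I m N ` space (vil_measure m))"
  unfolding vil_F_def by (intro sets_measure_of) (auto simp: vil_I_def)

lemma space_vil_F [simp]: "space (vil_F m N) = space (vil_measure m)"
  unfolding vil_F_def by (intro space_measure_of) (auto simp: vil_I_def)

lemma subalgebra_vil_F: "subalgebra (vil_measure m) (vil_F m N)"
  unfolding subalgebra_def sets_vil_F
  by (auto intro!: sets.sigma_sets_subset)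

lemma depends_on_sets:
  assumes "A \<in> sets (vil_F m N)"
  shows "depends_on N (\<lambda>x. x \<in> A)"
  using assms unfolding sets_vil_F
proof induction
  case (Basic a)
  then show ?case by (auto simp: depends_on_def vil_I_def)
next
  case Empty
  show ?case by (simp add: depends_on_def)
next
  case (Compl a)
  then show ?case unfolding depends_on_def by blast
next
  case (Union a)
  then show ?case unfolding depends_on_def by blast
qed

text \<open>The functions measurable for \<open>\<digamma>\<^sub>N\<close> are exactly those of the first \<open>N\<close> coordinates.\<close>

lemma depends_on_measurable:
  fixes h :: "_ \<Rightarrow> 'b::t1_space"
  assumes "h \<in> borel_measurable (vil_F m N)"
  shows "depends_on N h"
  unfolding depends_on_def
proof (intro ballI impI)
  fix x y assume xy: "x \<in> space (vil_measure m)" "y \<in> space (vil_measure m)" "\<forall>j<N. x j = y j"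
  have "h -` {h x} \<inter> space (vil_F m N) \<in> sets (vil_F m N)"
    using assms by (intro measurable_sets[where A = borel]) auto
  from depends_onD[OF depends_on_sets[OF this] xy(1,2)] xy show "h x = h y" by auto
qed

lemma measurable_depends_on:
  fixes h :: "_ \<Rightarrow> 'b::topological_space"
  assumes "depends_on N h"
  shows "h \<in> borel_measurable (vil_F m N)"
proof (rule measurableI)
  fix A assume "A \<in> sets (borel :: 'b measure)"
  have "h -` A \<inter> space (vil_measure m) = (\<Union>u\<in>{u\<in>{..<vil_M m N}. h (vil_digit m u) \<in> A}. cell N u)"
  proof (intro equalityI subsetI)
    fix x assume "x \<in> h -` A \<inter> space (vil_measure m)"
    then have x: "x \<in> space (vil_measure m)" "h x \<in> A" by auto
    obtain u where u: "u < vil_M m N" "\<And>j. j < N \<Longrightarrow> vil_digit m u j = x j"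
      using cell_unique[OF x(1)] by metis
    then have "h (vil_digit m u) = h x"
      using x by (intro depends_onD[OF assms]) auto
    then show "x \<in> (\<Union>u\<in>{u\<in>{..<vil_M m N}. h (vil_digit m u) \<in> A}. cell N u)"
      using u x by (auto simp: vil_I_def)
  next
    fix x assume "x \<in> (\<Union>u\<in>{u\<in>{..<vil_M m N}. h (vil_digit m u) \<in> A}. cell N u)"
    then obtain u where u: "x \<in> cell N u" "h (vil_digit m u) \<in> A" by auto
    then show "x \<in> h -` A \<inter> space (vil_measure m)"
      using depends_on_cell[OF u(1) _ assms] by (simp add: vil_I_def)
  qed
  also have "\<dots> \<in> sets (vil_F m N)"
    unfolding sets_vil_F by (intro sigma_sets_UNION countable_finite) (auto intro!: sigma_sets.Basic)
  finally show "h -` A \<inter> space (vil_F m N) \<in> sets (vil_F m N)" by simp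
qed simp

section \<open>Integration\<close>

lemma
  fixes g h :: "_ \<Rightarrow> complex"
  assumes g: "integrable (vil_measure m) g" and h: "depends_on N h"
  shows integrable_mult_depends_on: "integrable (vil_measure m) (\<lambda>x. g x * h x)"
    and integral_mult_depends_on: "(\<integral>x. g x * h x \<partial>vil_measure m)
      = (\<Sum>u<vil_M m N. h (vil_digit m u) * (LINT x:cell N u|vil_measure m. g x))"
proof -
  have eq: "g x * h x = (\<Sum>u<vil_M m N. h (vil_digit m u) * (indicator (cell N u) x *\<^sub>R g x))"
    if "x \<in> space (vil_measure m)" for x
  proof -
    have "g x * h x = g x * (\<Sum>u<vil_M m N. h (vil_digit m u) * indicator (cell N u) x)"
      using depends_on_expand[OF h that] by simp
    also have "\<dots> = (\<Sum>u<vil_M m N. h (vil_digit m u) * (indicator (cell N u) x *\<^sub>R g x))"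
      unfolding sum_distrib_left by (intro sum.cong refl) (simp add: indicator_def)
    finally show ?thesis .
  qed
  have int: "integrable (vil_measure m) (\<lambda>x. h (vil_digit m u) * (indicator (cell N u) x *\<^sub>R g x))" for u
    using g by (intro integrable_mult_right integrable_mult_indicator) auto
  show "integrable (vil_measure m) (\<lambda>x. g x * h x)"
    by (subst Bochner_Integration.integrable_cong[OF refl eq])
       (simp, intro Bochner_Integration.integrable_sum int)
  have "(\<integral>x. g x * h x \<partial>vil_measure m)
      = (\<integral>x. (\<Sum>u<vil_M m N. h (vil_digit m u) * (indicator (cell N u) x *\<^sub>R g x)) \<partial>vil_measure m)"
    by (intro Bochner_Integration.integral_cong refl eq)
  also have "\<dots> = (\<Sum>u<vil_M m N. \<integral>x. h (vil_digit m u) * (indicator (cell N u) x *\<^sub>R g x) \<partial>vil_measure m)"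
    by (intro Bochner_Integration.integral_sum int)
  finally show "(\<integral>x. g x * h x \<partial>vil_measure m)
      = (\<Sum>u<vil_M m N. h (vil_digit m u) * (LINT x:cell N u|vil_measure m. g x))"
    by (simp only: set_lebesgue_integral_def integral_mult_right_zero)
qed

lemma
  fixes h :: "_ \<Rightarrow> complex"
  assumes "depends_on N h"
  shows integrable_depends_on: "integrable (vil_measure m) h"
    and integral_depends_on:
      "(\<integral>x. h x \<partial>vil_measure m) = (\<Sum>u<vil_M m N. h (vil_digit m u)) / of_nat (vil_M m N)"
proof -
  show "integrable (vil_measure m) h"
    using integrable_mult_depends_on[of "\<lambda>_. 1", OF _ assms] by simp
  show "(\<integral>x. h x \<partial>vil_measure m) = (\<Sum>u<vil_M m N. h (vil_digit m u)) / of_nat (vil_M m N)"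
    using integral_mult_depends_on[of "\<lambda>_. 1", OF _ assms]
    by (simp add: measure_vil_I sum_divide_distrib scaleR_conv_of_real set_lebesgue_integral_def)
qed

lemma nn_integral_depends_on:
  assumes "depends_on N h"
  shows "(\<integral>\<^sup>+x. h x \<partial>vil_measure m)
    = (\<Sum>u<vil_M m N. h (vil_digit m u) * ennreal (1 / real (vil_M m N)))"
proof -
  have "(\<integral>\<^sup>+x. h x \<partial>vil_measure m)
      = (\<integral>\<^sup>+x. (\<Sum>u<vil_M m N. h (vil_digit m u) * indicator (cell N u) x) \<partial>vil_measure m)"
    using depends_on_expand[OF assms] by (intro nn_integral_cong) simp
  also have "\<dots> = (\<Sum>u<vil_M m N. h (vil_digit m u) * emeasure (vil_measure m) (cell N u))"
    by (subst nn_integral_sum) (simp_all add: nn_integral_cmult del: sum_mult_indicator)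
  finally show ?thesis by (simp add: emeasure_vil_I)
qed

lemma integrable_psi: "integrable (vil_measure m) (vil_psi m k)"
  using M_gt depends_on_psi by (intro integrable_depends_on[of k]) auto

text \<open>
  By the symmetry of the system the discrete inner product of \<open>\<psi>\<^sub>k\<close> and \<open>\<psi>\<^sub>i\<close> is the kernel
  \<open>D\<^bsub>M\<^sub>N\<^esub>\<close> at the digit sequences of \<open>k\<close> and \<open>i\<close>.
\<close>

lemma psi_orthonormal:
  "(\<integral>x. vil_psi m k x * cnj (vil_psi m i x) \<partial>vil_measure m) = (if k = i then 1 else 0)"
proof -
  define N where "N = k + i"
  have ki: "k < vil_M m N" "i < vil_M m N"
    using M_gt[of N] by (simp_all add: N_def)
  have "depends_on N (\<lambda>x. vil_psi m k x * cnj (vil_psi m i x))"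
    using depends_on_psi[OF ki(1)] depends_on_psi[OF ki(2)] unfolding depends_on_def by metis
  then have "(\<integral>x. vil_psi m k x * cnj (vil_psi m i x) \<partial>vil_measure m)
      = (\<Sum>u<vil_M m N. vil_psi m k (vil_digit m u) * cnj (vil_psi m i (vil_digit m u))) / of_nat (vil_M m N)"
    by (rule integral_depends_on)
  also have "(\<Sum>u<vil_M m N. vil_psi m k (vil_digit m u) * cnj (vil_psi m i (vil_digit m u)))
      = kern (vil_M m N) (vil_digit m k) (vil_digit m i)"
    unfolding kern_def using ki psi_symmetric by (intro sum.cong refl) simp
  also have "\<dots> = (if k = i then of_nat (vil_M m N) else 0)"
    using digit_inj[OF ki] digit_less by (subst kern_M) auto
  finally show ?thesis
    by (simp add: M_nonzero)
qed

section \<open>Martingales and their Fourier coefficients\<close>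

lemma cond_exp_locale: "sigma_finite_subalgebra (vil_measure m) (vil_F m n)"
proof (rule finite_measure_subalgebra_is_sigma_finite)
  have "finite_measure (vil_measure m)" by unfold_locales
  then show "finite_measure_subalgebra (vil_measure m) (vil_F m n)"
    using subalgebra_vil_F by (simp add: finite_measure_subalgebra_def finite_measure_subalgebra_axioms_def)
qed

lemma cell_in_vil_F: "cell n u \<in> sets (vil_F m n)"
  unfolding sets_vil_F by (intro sigma_sets.Basic imageI) simp

lemma martingale_depends_on: "vil_martingale m f \<Longrightarrow> depends_on n (f n)"
  by (intro depends_on_measurable) (simp add: vil_martingale_def)

lemma martingale_set_integral:
  assumes f: "vil_martingale m f" and nk: "n \<le> k" and A: "A \<in> sets (vil_F m n)"
  shows "(LINT x:A|vil_measure m. f k x) = (LINT x:A|vil_measure m. f n x)"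
proof -
  interpret C: sigma_finite_subalgebra "vil_measure m" "vil_F m n" by (rule cond_exp_locale)
  have AM: "A \<in> sets (vil_measure m)"
    using A subalgebra_vil_F[of n] by (auto simp: subalgebra_def)
  have int: "integrable (vil_measure m) (f j)" for j
    using f by (simp add: vil_martingale_def)
  then have sint: "integrable (vil_measure m) (\<lambda>x. indicator A x *\<^sub>R f j x)" for j
    using AM by (intro integrable_mult_indicator)
  have AE: "AE x in vil_measure m. complex_cond_exp (vil_measure m) (vil_F m n) (f k) x = f n x"
    using f nk by (simp add: vil_martingale_def)
  have meas: "f n \<in> borel_measurable (vil_measure m)"
    using int by (rule borel_measurable_integrable)
  have "Re (LINT x:A|vil_measure m. f k x) = (LINT x:A|vil_measure m. Re (f k x))"
    using sint by (simp add: set_lebesgue_integral_def flip: integral_Re)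
  also have "\<dots> = (LINT x:A|vil_measure m. real_cond_exp (vil_measure m) (vil_F m n) (\<lambda>y. Re (f k y)) x)"
    using int A by (intro C.real_cond_exp_intA integrable_Re)
  also have "\<dots> = (LINT x:A|vil_measure m. Re (f n x))"
    using AM meas AE by (intro set_lebesgue_integral_cong_AE) (auto simp: complex_cond_exp_def complex_eq_iff)
  also have "\<dots> = Re (LINT x:A|vil_measure m. f n x)"
    using sint by (simp add: set_lebesgue_integral_def flip: integral_Re)
  finally have re: "Re (LINT x:A|vil_measure m. f k x) = Re (LINT x:A|vil_measure m. f n x)" .
  have "Im (LINT x:A|vil_measure m. f k x) = (LINT x:A|vil_measure m. Im (f k x))"
    using sint by (simp add: set_lebesgue_integral_def flip: integral_Im)
  also have "\<dots> = (LINT x:A|vil_measure m. real_cond_exp (vil_measure m) (vil_F m n) (\<lambda>y. Im (f k y)) x)"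
    using int A by (intro C.real_cond_exp_intA integrable_Im)
  also have "\<dots> = (LINT x:A|vil_measure m. Im (f n x))"
    using AM meas AE by (intro set_lebesgue_integral_cong_AE) (auto simp: complex_cond_exp_def complex_eq_iff)
  also have "\<dots> = Im (LINT x:A|vil_measure m. f n x)"
    using sint by (simp add: set_lebesgue_integral_def flip: integral_Im)
  finally show ?thesis using re by (simp add: complex_eq_iff)
qed

text \<open>Functions of the first \<open>n\<close> coordinates with the averaging property form a martingale.\<close>

lemma martingaleI:
  assumes dep: "\<And>n. depends_on n (f n)"
    and eq: "\<And>n k A. n \<le> k \<Longrightarrow> A \<in> sets (vil_F m n) \<Longrightarrow>
      (LINT x:A|vil_measure m. f k x) = (LINT x:A|vil_measure m. f n x)"
  shows "vil_martingale m f"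
  unfolding vil_martingale_def
proof (intro conjI allI impI)
  show meas: "f n \<in> borel_measurable (vil_F m n)" for n
    using dep by (rule measurable_depends_on)
  show int: "integrable (vil_measure m) (f n)" for n
    using dep by (rule integrable_depends_on)
  fix n k :: nat assume nk: "n \<le> k"
  interpret C: sigma_finite_subalgebra "vil_measure m" "vil_F m n" by (rule cond_exp_locale)
  have AM: "A \<in> sets (vil_measure m)" if "A \<in> sets (vil_F m n)" for A
    using that subalgebra_vil_F[of n] by (auto simp: subalgebra_def)
  have sint: "integrable (vil_measure m) (\<lambda>x. indicator A x *\<^sub>R f j x)" if "A \<in> sets (vil_F m n)" for j A
    using int AM[OF that] by (intro integrable_mult_indicator)
  have "AE x in vil_measure m. real_cond_exp (vil_measure m) (vil_F m n) (\<lambda>y. Re (f k y)) x = Re (f n x)"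
  proof (intro C.real_cond_exp_charact integrable_Re int)
    show "(LINT x:A|vil_measure m. Re (f k x)) = (LINT x:A|vil_measure m. Re (f n x))"
      if "A \<in> sets (vil_F m n)" for A
      using eq[OF nk that] sint[OF that] integral_Re[of "vil_measure m" "\<lambda>x. indicator A x *\<^sub>R f k x"]
        integral_Re[of "vil_measure m" "\<lambda>x. indicator A x *\<^sub>R f n x"]
      by (simp add: set_lebesgue_integral_def del: integral_Re)
    show "(\<lambda>x. Re (f n x)) \<in> borel_measurable (vil_F m n)"
      using meas[of n] by simp
  qed
  moreover have "AE x in vil_measure m. real_cond_exp (vil_measure m) (vil_F m n) (\<lambda>y. Im (f k y)) x = Im (f n x)"
  proof (intro C.real_cond_exp_charact integrable_Im int)
    show "(LINT x:A|vil_measure m. Im (f k x)) = (LINT x:A|vil_measure m. Im (f n x))"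
      if "A \<in> sets (vil_F m n)" for A
      using eq[OF nk that] sint[OF that] integral_Im[of "vil_measure m" "\<lambda>x. indicator A x *\<^sub>R f k x"]
        integral_Im[of "vil_measure m" "\<lambda>x. indicator A x *\<^sub>R f n x"]
      by (simp add: set_lebesgue_integral_def del: integral_Im)
    show "(\<lambda>x. Im (f n x)) \<in> borel_measurable (vil_F m n)"
      using meas[of n] by simp
  qed
  ultimately show "AE x in vil_measure m. complex_cond_exp (vil_measure m) (vil_F m n) (f k) x = f n x"
    by eventually_elim (simp add: complex_cond_exp_def)
qed

lemma vil_coeff_eq:
  assumes f: "vil_martingale m f" and i: "i < vil_M m N"
  shows "vil_coeff m f i
    = (\<Sum>u<vil_M m N. f N (vil_digit m u) * cnj (vil_psi m i (vil_digit m u))) / of_nat (vil_M m N)"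
proof -
  let ?I = "\<lambda>k. \<integral>x. f k x * cnj (vil_psi m i x) \<partial>vil_measure m"
  have int: "integrable (vil_measure m) (f k)" for k
    using f by (simp add: vil_martingale_def)
  have dep: "depends_on N (\<lambda>x. cnj (vil_psi m i x))"
    using depends_on_psi[OF i] by (rule depends_on_comp)
  have "?I k = ?I N" if "N \<le> k" for k
    unfolding integral_mult_depends_on[OF int dep]
    by (simp only: martingale_set_integral[OF f that cell_in_vil_F])
  then have "?I \<longlonglongrightarrow> ?I N"
    by (intro tendsto_eventually eventually_sequentiallyI[of N])
  then have "vil_coeff m f i = ?I N"
    unfolding vil_coeff_def by (rule limI)
  also have "depends_on N (\<lambda>x. f N x * cnj (vil_psi m i x))"
    using martingale_depends_on[OF f, of N] dep unfolding depends_on_def by metis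
  then have "?I N = (\<Sum>u<vil_M m N. f N (vil_digit m u) * cnj (vil_psi m i (vil_digit m u)))
      / of_nat (vil_M m N)"
    by (rule integral_depends_on)
  finally show ?thesis .
qed

text \<open>The partial sum \<open>S\<^sub>n f\<close> is the convolution of any \<open>f\<^sub>N\<close> with \<open>n \<le> M\<^sub>N\<close> with the kernel.\<close>

lemma vil_S_eq:
  assumes f: "vil_martingale m f" and n: "n \<le> vil_M m N"
  shows "vil_S m n f x
    = (\<Sum>u<vil_M m N. f N (vil_digit m u) * kern n x (vil_digit m u)) / of_nat (vil_M m N)"
proof -
  have "vil_S m n f x = (\<Sum>k<n. (\<Sum>u<vil_M m N. f N (vil_digit m u) *
      (vil_psi m k x * cnj (vil_psi m k (vil_digit m u))))) / of_nat (vil_M m N)"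
    unfolding vil_S_def sum_divide_distrib[of _ "{..<n}"] using n
    by (intro sum.cong refl, subst vil_coeff_eq[OF f, of _ N])
       (simp_all add: sum_distrib_right mult.assoc mult.commute[of "cnj _"])
  also have "\<dots> = (\<Sum>u<vil_M m N. f N (vil_digit m u) * kern n x (vil_digit m u)) / of_nat (vil_M m N)"
    by (subst sum.swap) (simp add: kern_def sum_distrib_left)
  finally show ?thesis .
qed

text \<open>For \<open>n = M\<^sub>N\<close> the kernel is \<open>M\<^sub>N\<close> times the indicator of a cell, where \<open>f\<^sub>N\<close> is constant.\<close>

lemma vil_S_M:
  assumes f: "vil_martingale m f" and x: "x \<in> space (vil_measure m)"
  shows "vil_S m (vil_M m N) f x = f N x"
proof -
  have xj: "x j < m j" for j using x by (simp add: space_iff)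
  have "f N (vil_digit m u) * kern (vil_M m N) x (vil_digit m u)
      = of_nat (vil_M m N) * (f N (vil_digit m u) * indicator (cell N u) x)" for u
    using xj x by (subst kern_M) (auto simp: digit_less vil_I_def indicator_def)
  then have "vil_S m (vil_M m N) f x
      = of_nat (vil_M m N) * (\<Sum>u<vil_M m N. f N (vil_digit m u) * indicator (cell N u) x) / of_nat (vil_M m N)"
    using vil_S_eq[OF f order.refl] by (simp only: sum_distrib_left)
  also have "\<dots> = f N x"
    using depends_on_expand[OF martingale_depends_on[OF f] x, of N] M_nonzero[of N] by simp
  finally show ?thesis .
qed

lemma integrable_psi_cnj:
  "integrable (vil_measure m) (\<lambda>x. vil_psi m k x * cnj (vil_psi m i x))"
  by (rule integrable_mult_depends_on[OF integrable_psi
        depends_on_comp[OF depends_on_psi[OF M_gt], where g = cnj]])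

lemma vil_fun_coeff_trig:
  "vil_fun_coeff m (\<lambda>x. \<Sum>k<n. c k * vil_psi m k x) i = (if i < n then c i else 0)"
proof -
  have "vil_fun_coeff m (\<lambda>x. \<Sum>k<n. c k * vil_psi m k x) i
      = (\<integral>x. (\<Sum>k<n. c k * (vil_psi m k x * cnj (vil_psi m i x))) \<partial>vil_measure m)"
    by (simp add: vil_fun_coeff_def sum_distrib_right mult.assoc)
  also have "\<dots> = (\<Sum>k<n. c k * (if k = i then 1 else 0))"
    by (subst Bochner_Integration.integral_sum) (simp_all add: integrable_psi_cnj psi_orthonormal)
  also have "\<dots> = (\<Sum>k<n. if k = i then c k else 0)"
    by (intro sum.cong) auto
  finally show ?thesis by simp
qed

lemma vil_mart_of_vil_S:
  "vil_mart_of m (vil_S m n f) k x = vil_S m (min (vil_M m k) n) f x"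
proof -
  have "vil_mart_of m (vil_S m n f) k x
      = (\<Sum>i<vil_M m k. (if i < n then vil_coeff m f i else 0) * vil_psi m i x)"
    by (simp add: vil_mart_of_def vil_fun_S_def vil_S_def[abs_def] vil_fun_coeff_trig)
  also have "\<dots> = (\<Sum>i<min (vil_M m k) n. vil_coeff m f i * vil_psi m i x)"
    by (intro sum.mono_neutral_cong_right) auto
  finally show ?thesis by (simp add: vil_S_def)
qed

text \<open>The indicator of a cell of level \<open>n\<close> is spanned by the \<open>\<psi>\<^sub>j\<close> with \<open>j < M\<^sub>n\<close>.\<close>

lemma indicator_cell_eq:
  assumes "x \<in> space (vil_measure m)"
  shows "indicator (cell n u) x
    = (\<Sum>j<vil_M m n. vil_psi m j (vil_digit m u) * cnj (vil_psi m j x)) / complex_of_nat (vil_M m n)"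
proof -
  have "kern (vil_M m n) (vil_digit m u) x = of_nat (vil_M m n) * indicator (cell n u) x"
    using assms by (subst kern_M) (auto simp: digit_less space_iff vil_I_def indicator_def)
  then show ?thesis
    using M_nonzero[of n] by (simp add: kern_def)
qed

lemma set_integral_psi_cell:
  assumes "vil_M m n \<le> i"
  shows "(LINT x:cell n u|vil_measure m. vil_psi m i x) = 0"
proof -
  have "(LINT x:cell n u|vil_measure m. vil_psi m i x)
      = (\<integral>x. (\<Sum>j<vil_M m n. vil_psi m j (vil_digit m u) / of_nat (vil_M m n)
          * (vil_psi m i x * cnj (vil_psi m j x))) \<partial>vil_measure m)"
    unfolding set_lebesgue_integral_def
  proof (intro Bochner_Integration.integral_cong refl)
    fix x assume "x \<in> space (vil_measure m)"
    have "indicator (cell n u) x *\<^sub>R vil_psi m i x = indicator (cell n u) x * vil_psi m i x"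
      by (simp add: indicator_def)
    also have "\<dots> = (\<Sum>j<vil_M m n. vil_psi m j (vil_digit m u) / of_nat (vil_M m n)
          * (vil_psi m i x * cnj (vil_psi m j x)))"
      unfolding indicator_cell_eq[OF \<open>x \<in> space (vil_measure m)\<close>] sum_divide_distrib sum_distrib_right
      by (intro sum.cong refl) (simp add: mult_ac)
    finally show "indicator (cell n u) x *\<^sub>R vil_psi m i x = \<dots>" .
  qed
  also have "\<dots> = 0"
    using assms by (subst Bochner_Integration.integral_sum) (auto simp: integrable_psi_cnj psi_orthonormal)
  finally show ?thesis .
qed

text \<open>Every sequence of coefficients is the Fourier series of a martingale.\<close>

definition trig_martingale :: "(nat \<Rightarrow> complex) \<Rightarrow> nat \<Rightarrow> (nat \<Rightarrow> nat) \<Rightarrow> complex" where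
  "trig_martingale c n x = (\<Sum>k<vil_M m n. c k * vil_psi m k x)"

lemma martingale_trig: "vil_martingale m (trig_martingale c)"
proof (rule martingaleI)
  show dep: "depends_on n (trig_martingale c n)" for n
    unfolding depends_on_def trig_martingale_def
    by (intro ballI impI sum.cong refl arg_cong2[where f = "(*)"] psi_cong) auto
  fix n k :: nat and A assume nk: "n \<le> k" and A: "A \<in> sets (vil_F m n)"
  have int: "integrable (vil_measure m) (trig_martingale c j)" for j
    using dep by (rule integrable_depends_on)
  have depA: "depends_on n (\<lambda>x. indicator A x :: complex)"
    using depends_on_comp[OF depends_on_sets[OF A], of "\<lambda>b. if b then 1 else 0"]
    by (simp add: indicator_def of_bool_def)
  have scaleR: "indicator A x *\<^sub>R y = y * indicator A x" for x and y :: complex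
    by (simp add: indicator_def)
  have sint: "set_integrable (vil_measure m) (cell n u) (\<lambda>x. c i * vil_psi m i x)" for u i
    unfolding set_integrable_def by (intro integrable_mult_indicator integrable_mult_right integrable_psi) simp
  have cell: "(LINT x:cell n u|vil_measure m. trig_martingale c k x)
      = (LINT x:cell n u|vil_measure m. trig_martingale c n x)" for u
  proof -
    have split: "(LINT x:cell n u|vil_measure m. trig_martingale c j x)
        = (\<Sum>i<vil_M m j. c i * (LINT x:cell n u|vil_measure m. vil_psi m i x))" for j
      unfolding trig_martingale_def
      using sint unfolding set_lebesgue_integral_def set_integrable_def scaleR_sum_right
      by (subst Bochner_Integration.integral_sum)
         (simp_all only: mult_scaleR_right[symmetric] integral_mult_right_zero)
    show ?thesis
      unfolding split using M_mono[OF nk] set_integral_psi_cell[of n _ u]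
      by (intro sum.mono_neutral_right) auto
  qed
  show "(LINT x:A|vil_measure m. trig_martingale c k x) = (LINT x:A|vil_measure m. trig_martingale c n x)"
    unfolding set_lebesgue_integral_def scaleR integral_mult_depends_on[OF int depA]
    by (simp only: cell flip: set_lebesgue_integral_def)
qed

lemma vil_coeff_trig: "vil_coeff m (trig_martingale c) i = c i"
proof -
  have "vil_fun_coeff m (trig_martingale c k) i = c i" if "i \<le> k" for k
    using that M_gt[of k] vil_fun_coeff_trig[of c "vil_M m k" i] by (simp add: trig_martingale_def[abs_def])
  then have "(\<lambda>k. vil_fun_coeff m (trig_martingale c k) i) \<longlonglongrightarrow> c i"
    by (intro tendsto_eventually eventually_sequentiallyI[of i])
  then show ?thesis
    unfolding vil_coeff_def vil_fun_coeff_def by (rule limI)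
qed

lemma vil_S_trig: "vil_S m n (trig_martingale c) x = (\<Sum>k<n. c k * vil_psi m k x)"
  by (simp add: vil_S_def vil_coeff_trig)

end

section \<open>Powers on the extended half-line\<close>

lemma ennreal_rpow_ennreal: "0 \<le> x \<Longrightarrow> ennreal_rpow (ennreal x) p = ennreal (x powr p)"
  by (simp add: ennreal_rpow_def)

lemma ennreal_rpow_mono:
  assumes "x \<le> y" "0 \<le> p" shows "ennreal_rpow x p \<le> ennreal_rpow y p"
proof (cases "y = \<infinity>")
  case False
  then have "x \<noteq> \<infinity>" using assms(1) by (auto simp: top_unique)
  moreover have "enn2real x \<le> enn2real y"
    using assms(1) False by (intro enn2real_mono) (auto simp: less_top)
  ultimately show ?thesis
    using False assms(2) by (auto simp: ennreal_rpow_def intro!: ennreal_leI powr_mono2)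
qed (simp add: ennreal_rpow_def)

lemma ennreal_rpow_inverse:
  assumes "0 < p" shows "ennreal_rpow (ennreal_rpow x p) (1 / p) = x"
  using assms by (cases x) (auto simp: ennreal_rpow_def powr_powr)

lemma ennreal_rpow_mult:
  assumes "0 < K"
  shows "ennreal_rpow (ennreal K * J) p = ennreal (K powr p) * ennreal_rpow J p"
proof (cases J)
  case (real r)
  then show ?thesis using assms
    by (simp add: ennreal_rpow_ennreal powr_mult flip: ennreal_mult)
next
  case top
  then show ?thesis using assms by (simp add: ennreal_rpow_def ennreal_mult_top)
qed

lemma measurable_ennreal_rpow [measurable]:
  "(\<lambda>x. ennreal_rpow x p) \<in> borel_measurable borel"
  unfolding ennreal_rpow_def by measurable

text \<open>Pointwise bounds for \<open>|f\<^sub>n|\<^sup>p\<close> pass to the maximal function, also where the bound is infinite.\<close>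

lemma max_fun_rpow_le:
  assumes p: "0 < p" and le: "\<And>n. ennreal (norm (f n x) powr p) \<le> G"
  shows "ennreal_rpow (max_fun f x) p \<le> G"
proof -
  have "ennreal (norm (f n x)) \<le> ennreal_rpow G (1 / p)" for n
    using ennreal_rpow_mono[OF le, of "1 / p" n] ennreal_rpow_inverse[OF p, of "ennreal (norm (f n x))"] p
    by (simp add: ennreal_rpow_ennreal)
  then have "max_fun f x \<le> ennreal_rpow G (1 / p)"
    unfolding max_fun_def by (intro SUP_least)
  then have "ennreal_rpow (max_fun f x) p \<le> ennreal_rpow (ennreal_rpow G (1 / p)) p"
    using p by (intro ennreal_rpow_mono) auto
  also have "\<dots> = G"
    using ennreal_rpow_inverse[of "1 / p" G] p by simp
  finally show ?thesis .
qed

lemma powr_norm_le_max_fun: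
  assumes "0 < p"
  shows "ennreal (norm (f n x) powr p) \<le> ennreal_rpow (max_fun f x) p"
proof -
  have "ennreal (norm (f n x) powr p) = ennreal_rpow (ennreal (norm (f n x))) p"
    by (simp add: ennreal_rpow_ennreal)
  also have "\<dots> \<le> ennreal_rpow (max_fun f x) p"
    using assms unfolding max_fun_def by (intro ennreal_rpow_mono SUP_upper) auto
  finally show ?thesis .
qed

lemma powr_add_le:
  fixes a b :: real
  assumes "0 \<le> a" "0 \<le> b" "0 < p" "p \<le> 1"
  shows "(a + b) powr p \<le> a powr p + b powr p"
proof (cases "a = 0 \<or> b = 0")
  case False
  then have pos: "0 < a" "0 < b" using assms by auto
  have split: "x powr p = x * x powr (p - 1)" if "0 < x" for x :: real
    using that by (simp add: powr_diff)
  have "(a + b) powr p = a * (a + b) powr (p - 1) + b * (a + b) powr (p - 1)"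
    using pos by (simp add: split distrib_right)
  also have "\<dots> \<le> a * a powr (p - 1) + b * b powr (p - 1)"
    using pos assms by (intro add_mono mult_left_mono powr_mono2') auto
  finally show ?thesis using pos by (simp add: split)
qed auto

lemma powr_sum_le:
  fixes a :: "'a \<Rightarrow> real"
  assumes "finite I" "\<And>i. i \<in> I \<Longrightarrow> 0 \<le> a i" "0 < p" "p \<le> 1"
  shows "(\<Sum>i\<in>I. a i) powr p \<le> (\<Sum>i\<in>I. a i powr p)"
  using assms(1,2)
proof (induction I rule: finite_induct)
  case (insert i I)
  then have "(\<Sum>i\<in>insert i I. a i) powr p \<le> a i powr p + (\<Sum>i\<in>I. a i) powr p"
    using powr_add_le[of "a i" "\<Sum>i\<in>I. a i" p] assms(3,4) by (simp add: sum_nonneg)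
  then show ?case using insert by simp
qed simp

section \<open>The upper estimate\<close>

context vilenkin
begin

lemma M_add_ge: "2 ^ d * vil_M m k \<le> vil_M m (k + d)"
proof (induction d)
  case (Suc d)
  have "2 * (2 ^ d * vil_M m k) \<le> 2 * vil_M m (k + d)"
    using Suc by (rule mult_left_mono) simp
  also have "\<dots> \<le> vil_M m (Suc (k + d))"
    by (rule M_Suc_ge)
  finally show ?case by simp
qed simp

lemma sum_M_powr_le:
  assumes q: "q < 0"
  shows "(\<Sum>s=L..L+d. real (vil_M m s) powr q) \<le> real (vil_M m L) powr q / (1 - 2 powr q)"
proof -
  have r: "0 \<le> 2 powr q" "2 powr q < (1::real)"
    using q by (auto simp: powr_less_one)
  have "(\<Sum>s=L..L+d. real (vil_M m s) powr q) = (\<Sum>i\<le>d. real (vil_M m (L + i)) powr q)"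
    using sum.shift_bounds_cl_nat_ivl[of "\<lambda>s. real (vil_M m s) powr q" 0 L d]
    by (simp add: atMost_atLeast0 add.commute)
  also have "\<dots> \<le> (\<Sum>i\<le>d. real (vil_M m L) powr q * (2 powr q) ^ i)"
  proof (intro sum_mono)
    fix i
    have "real (2 ^ i * vil_M m L) \<le> real (vil_M m (L + i))"
      using M_add_ge by (intro of_nat_mono)
    then have "real (vil_M m (L + i)) powr q \<le> (2 ^ i * real (vil_M m L)) powr q"
      using q M_pos[of L] by (intro powr_mono2') auto
    also have "\<dots> = real (vil_M m L) powr q * (2 powr q) ^ i"
      by (simp add: powr_mult powr_realpow[symmetric] powr_powr mult.commute)
    finally show "real (vil_M m (L + i)) powr q \<le> real (vil_M m L) powr q * (2 powr q) ^ i" .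
  qed
  also have "\<dots> = real (vil_M m L) powr q * (\<Sum>i\<le>d. (2 powr q) ^ i)"
    by (simp add: sum_distrib_left)
  also have "(\<Sum>i\<le>d. (2 powr q) ^ i) = (1 - (2 powr q) ^ Suc d) / (1 - 2 powr q)"
    using r q by (subst sum_gp0) simp
  also have "real (vil_M m L) powr q * \<dots> \<le> real (vil_M m L) powr q * (1 / (1 - 2 powr q))"
    using r by (intro mult_left_mono divide_right_mono) auto
  finally show ?thesis by simp
qed

text \<open>
  Let \<open>s\<close> be the first position where \<open>x\<close> and \<open>t\<close> differ. The kernel vanishes if \<open>s < \<langle>n\<rangle>\<close>, is at
  most \<open>M\<^bsub>s+1\<^esub>\<close> if \<open>\<langle>n\<rangle> \<le> s \<le> |n|\<close>, and at most \<open>n\<close> otherwise.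
\<close>

lemma kern_powr_le:
  assumes n: "0 < n" and p: "0 < p"
    and x: "x \<in> space (vil_measure m)" and t: "t \<in> space (vil_measure m)"
  shows "norm (kern n x t) powr p
    \<le> (\<Sum>s=vil_low m n..vil_high m n. real (vil_M m (Suc s)) powr p * indicator (vil_I m s t) x)"
    (is "_ \<le> (\<Sum>s=?L..?H. ?g s)")
proof -
  have xt: "x j < m j" "t j < m j" for j using x t by (auto simp: space_iff)
  have bound: "norm (kern n x t) powr p \<le> (\<Sum>s=?L..?H. ?g s)"
    if "s \<in> {?L..?H}" "\<And>j. j < s \<Longrightarrow> x j = t j" "norm (kern n x t) \<le> real (vil_M m (Suc s))" for s
  proof -
    have "norm (kern n x t) powr p \<le> ?g s"
      using that x p by (auto simp: vil_I_def intro!: powr_mono2)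
    also have "\<dots> \<le> (\<Sum>s=?L..?H. ?g s)"
      using that(1) by (intro member_le_sum) auto
    finally show ?thesis .
  qed
  show ?thesis
  proof (cases "\<forall>j\<le>?H. x j = t j")
    case True
    have "norm (kern n x t) \<le> real (vil_M m (Suc ?H))"
      using norm_kern_le[of n x t] high_bounds(2)[OF n] by linarith
    then show ?thesis
      using True low_le_high[OF n] by (intro bound[of ?H]) auto
  next
    case False
    then obtain j where j: "j \<le> ?H" "x j \<noteq> t j" by auto
    define s where "s = (LEAST j. x j \<noteq> t j)"
    have "s \<le> j"
      unfolding s_def using j(2) by (rule Least_le)
    moreover have "x s \<noteq> t s"
      unfolding s_def using j(2) by (rule LeastI)
    ultimately have s: "s \<le> ?H" "x s \<noteq> t s"
      using j(1) by simp_all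
    have eq: "x i = t i" if "i < s" for i
      using not_less_Least[OF that[unfolded s_def]] by simp
    show ?thesis
    proof (cases "s < ?L")
      case True
      then show ?thesis
        using kern_below_low[OF xt s(2) True] by (auto intro!: sum_nonneg)
    next
      case False
      then show ?thesis
        using s eq norm_kern_less[OF xt s(2)] by (intro bound[of s]) auto
    qed
  qed
qed

lemma measurable_psi [measurable]: "vil_psi m k \<in> borel_measurable (vil_measure m)"
  using integrable_psi by (rule borel_measurable_integrable)

lemma measurable_vil_S [measurable]: "vil_S m n f \<in> borel_measurable (vil_measure m)"
  unfolding vil_S_def[abs_def] by measurable

lemma measurable_kern [measurable]: "(\<lambda>x. kern n x t) \<in> borel_measurable (vil_measure m)"
  unfolding kern_def by measurable

end

text \<open>The bounded case; \<open>B\<close> is any upper bound of the \<open>m\<^sub>k\<close>.\<close>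

locale bounded_vilenkin = vilenkin +
  fixes B :: nat
  assumes m_le: "m k \<le> B"
begin

lemma B_ge2: "2 \<le> B"
  using ge2[of 0] m_le[of 0] by simp

lemma M_Suc_le: "vil_M m (Suc k) \<le> B * vil_M m k"
  using m_le by simp

lemma nn_integral_kern_powr_le:
  assumes n: "0 < n" and p: "0 < p" "p < 1" and t: "t \<in> space (vil_measure m)"
  shows "(\<integral>\<^sup>+x. ennreal (norm (kern n x t) powr p) \<partial>vil_measure m)
    \<le> ennreal (real B powr p * (real (vil_M m (vil_low m n)) powr (p - 1) / (1 - 2 powr (p - 1))))"
proof -
  let ?L = "vil_low m n" and ?H = "vil_high m n"
  have "(\<integral>\<^sup>+x. ennreal (norm (kern n x t) powr p) \<partial>vil_measure m)
      \<le> (\<integral>\<^sup>+x. (\<Sum>s=?L..?H. ennreal (real (vil_M m (Suc s)) powr p) * indicator (vil_I m s t) x) \<partial>vil_measure m)"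
  proof (rule nn_integral_mono)
    fix x assume x: "x \<in> space (vil_measure m)"
    have "ennreal (norm (kern n x t) powr p)
        \<le> ennreal (\<Sum>s=?L..?H. real (vil_M m (Suc s)) powr p * indicator (vil_I m s t) x)"
      by (intro ennreal_leI kern_powr_le n p x t)
    also have "\<dots> = (\<Sum>s=?L..?H. ennreal (real (vil_M m (Suc s)) powr p * indicator (vil_I m s t) x))"
      by (subst sum_ennreal) auto
    also have "\<dots> = (\<Sum>s=?L..?H. ennreal (real (vil_M m (Suc s)) powr p) * indicator (vil_I m s t) x)"
      by (intro sum.cong refl) (simp add: indicator_def)
    finally show "ennreal (norm (kern n x t) powr p) \<le> \<dots>" .
  qed
  also have "\<dots> = (\<Sum>s=?L..?H. ennreal (real (vil_M m (Suc s)) powr p) * ennreal (1 / real (vil_M m s)))"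
    by (subst nn_integral_sum) (simp_all add: nn_integral_cmult emeasure_vil_I[OF t] del: sum_mult_indicator vil_M.simps)
  also have "\<dots> = ennreal (\<Sum>s=?L..?H. real (vil_M m (Suc s)) powr p * (1 / real (vil_M m s)))"
    by (subst sum_ennreal[symmetric]) (simp_all add: ennreal_mult[symmetric] del: vil_M.simps)
  also have "\<dots> \<le> ennreal (\<Sum>s=?L..?H. real B powr p * real (vil_M m s) powr (p - 1))"
  proof (intro ennreal_leI sum_mono)
    fix s
    have "real (vil_M m (Suc s)) \<le> real B * real (vil_M m s)"
      using of_nat_mono[OF M_Suc_le[of s], where 'a = real] by simp
    then have "real (vil_M m (Suc s)) powr p \<le> (real B * real (vil_M m s)) powr p"
      using p by (intro powr_mono2) auto
    then have "real (vil_M m (Suc s)) powr p * (1 / real (vil_M m s))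
        \<le> (real B * real (vil_M m s)) powr p * (1 / real (vil_M m s))"
      by (intro mult_right_mono) auto
    also have "\<dots> = real B powr p * real (vil_M m s) powr (p - 1)"
      using M_pos[of s] by (simp add: powr_mult powr_diff)
    finally show "real (vil_M m (Suc s)) powr p * (1 / real (vil_M m s))
        \<le> real B powr p * real (vil_M m s) powr (p - 1)" .
  qed
  also have "\<dots> \<le> ennreal (real B powr p * (real (vil_M m ?L) powr (p - 1) / (1 - 2 powr (p - 1))))"
    using sum_M_powr_le[of "p - 1" ?L "?H - ?L"] p low_le_high[OF n]
    unfolding sum_distrib_left[symmetric] by (intro ennreal_leI mult_left_mono) auto
  finally show ?thesis .
qed

text \<open>
  At the scale \<open>N = |n| + 1\<close> the convolution \<open>S\<^sub>n f = f\<^sub>N * D\<^sub>n\<close> is a finite sum over cells, so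
  \<open>p\<close>-subadditivity bounds \<open>\<integral>|S\<^sub>n f|\<^sup>p\<close> by \<open>\<integral>|f\<^sub>N|\<^sup>p\<close> times \<open>M\<^sub>N\<^bsup>1-p\<^esup> \<integral>|D\<^sub>n|\<^sup>p\<close>.
\<close>

lemma nn_integral_vil_S_powr_le:
  assumes f: "vil_martingale m f" and n: "0 < n" and p: "0 < p" "p < 1"
  shows "(\<integral>\<^sup>+x. ennreal (norm (vil_S m n f x) powr p) \<partial>vil_measure m)
    \<le> ennreal (real B / (1 - 2 powr (p - 1)) *
        (real (vil_M m (vil_high m n)) / real (vil_M m (vil_low m n))) powr (1 - p))
      * (\<integral>\<^sup>+x. ennreal (norm (f (Suc (vil_high m n)) x) powr p) \<partial>vil_measure m)"
proof -
  define N L where "N = Suc (vil_high m n)" and "L = vil_low m n"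
  define C where "C = real B powr p * (real (vil_M m L) powr (p - 1) / (1 - 2 powr (p - 1)))"
  have two: "2 powr (p - 1) < (1::real)" using p by (simp add: powr_less_one)
  then have C: "0 \<le> C" by (simp add: C_def)
  let ?a = "\<lambda>u. norm (f N (vil_digit m u)) / real (vil_M m N)"
  have "(\<integral>\<^sup>+x. ennreal (norm (vil_S m n f x) powr p) \<partial>vil_measure m)
      \<le> (\<integral>\<^sup>+x. (\<Sum>u<vil_M m N. ennreal (?a u powr p) * ennreal (norm (kern n x (vil_digit m u)) powr p)) \<partial>vil_measure m)"
  proof (rule nn_integral_mono)
    fix x
    have "n \<le> vil_M m N"
      using high_bounds(2)[OF n] unfolding N_def by (rule less_imp_le)
    then have "norm (vil_S m n f x)
        = norm (\<Sum>u<vil_M m N. f N (vil_digit m u) * kern n x (vil_digit m u)) / real (vil_M m N)"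
      by (simp only: vil_S_eq[OF f] norm_divide norm_of_nat)
    also have "\<dots> \<le> (\<Sum>u<vil_M m N. norm (f N (vil_digit m u) * kern n x (vil_digit m u))) / real (vil_M m N)"
      by (intro divide_right_mono norm_sum) simp
    also have "\<dots> = (\<Sum>u<vil_M m N. ?a u * norm (kern n x (vil_digit m u)))"
      by (simp add: sum_divide_distrib norm_mult)
    finally have "norm (vil_S m n f x) powr p
        \<le> (\<Sum>u<vil_M m N. ?a u * norm (kern n x (vil_digit m u))) powr p"
      using p by (intro powr_mono2) auto
    also have "\<dots> \<le> (\<Sum>u<vil_M m N. (?a u * norm (kern n x (vil_digit m u))) powr p)"
      using p by (intro powr_sum_le) auto
    also have "\<dots> = (\<Sum>u<vil_M m N. ?a u powr p * norm (kern n x (vil_digit m u)) powr p)"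
      by (intro sum.cong refl, subst powr_mult) auto
    finally have "ennreal (norm (vil_S m n f x) powr p) \<le> ennreal \<dots>"
      by (rule ennreal_leI)
    also have "\<dots> = (\<Sum>u<vil_M m N. ennreal (?a u powr p) * ennreal (norm (kern n x (vil_digit m u)) powr p))"
      by (simp add: sum_ennreal[symmetric] ennreal_mult)
    finally show "ennreal (norm (vil_S m n f x) powr p) \<le> \<dots>" .
  qed
  also have "\<dots> = (\<Sum>u<vil_M m N. ennreal (?a u powr p)
      * (\<integral>\<^sup>+x. ennreal (norm (kern n x (vil_digit m u)) powr p) \<partial>vil_measure m))"
    by (subst nn_integral_sum) (auto intro!: sum.cong nn_integral_cmult)
  also have "\<dots> \<le> (\<Sum>u<vil_M m N. ennreal (?a u powr p) * ennreal C)"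
    unfolding C_def L_def using n p
    by (intro sum_mono mult_left_mono nn_integral_kern_powr_le) auto
  also have "\<dots> = (\<Sum>u<vil_M m N. ennreal (C * real (vil_M m N) powr (1 - p))
      * (ennreal (norm (f N (vil_digit m u)) powr p) * ennreal (1 / real (vil_M m N))))"
  proof (intro sum.cong refl)
    fix u
    have "?a u powr p * C = C * real (vil_M m N) powr (1 - p) * (norm (f N (vil_digit m u)) powr p * (1 / real (vil_M m N)))"
      using M_pos[of N] by (simp add: powr_divide powr_diff)
    then show "ennreal (?a u powr p) * ennreal C = ennreal (C * real (vil_M m N) powr (1 - p))
      * (ennreal (norm (f N (vil_digit m u)) powr p) * ennreal (1 / real (vil_M m N)))"
      using C by (simp flip: ennreal_mult)
  qed
  also have "\<dots> = ennreal (C * real (vil_M m N) powr (1 - p))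
      * (\<integral>\<^sup>+x. ennreal (norm (f N x) powr p) \<partial>vil_measure m)"
    using nn_integral_depends_on[OF depends_on_comp[OF martingale_depends_on[OF f, of N],
        where g = "\<lambda>z. ennreal (norm z powr p)"]]
    by (simp add: sum_distrib_left)
  also have "\<dots> \<le> ennreal (real B / (1 - 2 powr (p - 1)) *
        (real (vil_M m (vil_high m n)) / real (vil_M m L)) powr (1 - p))
      * (\<integral>\<^sup>+x. ennreal (norm (f N x) powr p) \<partial>vil_measure m)"
  proof (intro mult_right_mono ennreal_leI)
    have "real (vil_M m N) \<le> real B * real (vil_M m (vil_high m n))"
      using of_nat_mono[OF M_Suc_le[of "vil_high m n"], where 'a = real] by (simp add: N_def)
    then have "C * real (vil_M m N) powr (1 - p) \<le> C * (real B * real (vil_M m (vil_high m n))) powr (1 - p)"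
      using C p by (intro mult_left_mono powr_mono2) auto
    also have "\<dots> = (real B powr p * real B powr (1 - p)) / (1 - 2 powr (p - 1))
        * (real (vil_M m (vil_high m n)) powr (1 - p) * real (vil_M m L) powr (p - 1))"
      by (simp add: C_def powr_mult)
    also have "real B powr p * real B powr (1 - p) = real B"
      using B_ge2 by (simp flip: powr_add)
    also have "real (vil_M m (vil_high m n)) powr (1 - p) * real (vil_M m L) powr (p - 1)
        = (real (vil_M m (vil_high m n)) / real (vil_M m L)) powr (1 - p)"
      using M_pos[of L] powr_minus[of "real (vil_M m L)" "1 - p"] by (subst powr_divide) (simp_all add: divide_inverse)
    finally show "C * real (vil_M m N) powr (1 - p) \<le> real B / (1 - 2 powr (p - 1)) *
        (real (vil_M m (vil_high m n)) / real (vil_M m L)) powr (1 - p)" .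
  qed simp
  finally show ?thesis by (simp only: N_def L_def)
qed

lemma measurable_max_fun:
  assumes "vil_martingale m f"
  shows "max_fun f \<in> borel_measurable (vil_measure m)"
proof -
  have [measurable]: "f n \<in> borel_measurable (vil_measure m)" for n
    using assms by (intro borel_measurable_integrable) (simp add: vil_martingale_def)
  show ?thesis unfolding max_fun_def[abs_def] by measurable
qed

text \<open>
  The martingale of \<open>S\<^sub>n f\<close> consists of members of \<open>f\<close> and of \<open>S\<^sub>n f\<close> itself, so its maximal
  function is at most the maximum of that of \<open>f\<close> and of \<open>|S\<^sub>n f|\<close>.
\<close>

lemma Hp_norm_vil_S_le:
  assumes f: "vil_martingale m f" and n: "0 < n" and p: "0 < p" "p < 1"
  shows "Hp_norm m p (vil_mart_of m (vil_S m n f))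
    \<le> ennreal ((1 + real B / (1 - 2 powr (p - 1))) powr (1 / p)
        * real (vil_M m (vil_high m n)) powr (1 / p - 1) / real (vil_M m (vil_low m n)) powr (1 / p - 1))
      * Hp_norm m p f"
proof -
  define C where "C = real B / (1 - 2 powr (p - 1))"
  define R where "R = real (vil_M m (vil_high m n)) / real (vil_M m (vil_low m n))"
  define J where "J = (\<integral>\<^sup>+x. ennreal_rpow (max_fun f x) p \<partial>vil_measure m)"
  note [measurable] = measurable_max_fun[OF f]
  have C: "0 \<le> C" using p by (simp add: C_def powr_less_one less_imp_le)
  have R: "1 \<le> R"
    using M_mono[OF low_le_high[OF n]] M_pos by (simp add: R_def)
  have "(\<integral>\<^sup>+x. ennreal_rpow (max_fun (vil_mart_of m (vil_S m n f)) x) p \<partial>vil_measure m)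
      \<le> (\<integral>\<^sup>+x. ennreal_rpow (max_fun f x) p + ennreal (norm (vil_S m n f x) powr p) \<partial>vil_measure m)"
  proof (rule nn_integral_mono)
    fix x assume x: "x \<in> space (vil_measure m)"
    show "ennreal_rpow (max_fun (vil_mart_of m (vil_S m n f)) x) p
        \<le> ennreal_rpow (max_fun f x) p + ennreal (norm (vil_S m n f x) powr p)"
    proof (rule max_fun_rpow_le[OF p(1)])
      fix k
      show "ennreal (norm (vil_mart_of m (vil_S m n f) k x) powr p)
          \<le> ennreal_rpow (max_fun f x) p + ennreal (norm (vil_S m n f x) powr p)"
      proof (cases "vil_M m k \<le> n")
        case True
        then have "vil_mart_of m (vil_S m n f) k x = f k x"
          using vil_S_M[OF f x] by (simp add: vil_mart_of_vil_S)
        then show ?thesis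
          using powr_norm_le_max_fun[OF p(1), of f k x] by (simp add: add_increasing2)
      next
        case False
        then show ?thesis by (simp add: vil_mart_of_vil_S min_def)
      qed
    qed
  qed
  also have "\<dots> = J + (\<integral>\<^sup>+x. ennreal (norm (vil_S m n f x) powr p) \<partial>vil_measure m)"
    unfolding J_def by (intro nn_integral_add) measurable
  also have "\<dots> \<le> J + ennreal (C * R powr (1 - p)) * J"
  proof (intro add_left_mono order.trans[OF nn_integral_vil_S_powr_le[OF f n p]])
    show "ennreal (real B / (1 - 2 powr (p - 1)) *
        (real (vil_M m (vil_high m n)) / real (vil_M m (vil_low m n))) powr (1 - p))
      * (\<integral>\<^sup>+x. ennreal (norm (f (Suc (vil_high m n)) x) powr p) \<partial>vil_measure m)
      \<le> ennreal (C * R powr (1 - p)) * J"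
      unfolding C_def[symmetric] R_def[symmetric] J_def
      by (intro mult_left_mono nn_integral_mono powr_norm_le_max_fun p) simp
  qed
  also have "\<dots> = ennreal (1 + C * R powr (1 - p)) * J"
    using C by (simp add: distrib_right)
  also have "\<dots> \<le> ennreal ((1 + C) * R powr (1 - p)) * J"
    using C R p by (intro mult_right_mono ennreal_leI) (auto simp: distrib_right intro!: ge_one_powr_ge_zero)
  finally have "Hp_norm m p (vil_mart_of m (vil_S m n f))
      \<le> ennreal_rpow (ennreal ((1 + C) * R powr (1 - p)) * J) (1 / p)"
    unfolding Hp_norm_def using p by (intro ennreal_rpow_mono) auto
  also have "\<dots> = ennreal (((1 + C) * R powr (1 - p)) powr (1 / p)) * Hp_norm m p f"
    using C R by (subst ennreal_rpow_mult) (auto simp: Hp_norm_def J_def)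
  also have "((1 + C) * R powr (1 - p)) powr (1 / p) = (1 + C) powr (1 / p) * R powr (1 / p - 1)"
    using C R p by (simp add: powr_mult powr_powr diff_divide_distrib)
  also have "\<dots> = (1 + C) powr (1 / p) * real (vil_M m (vil_high m n)) powr (1 / p - 1)
      / real (vil_M m (vil_low m n)) powr (1 / p - 1)"
    by (simp add: R_def powr_divide)
  finally show ?thesis unfolding C_def .
qed

end

section \<open>Lacunary martingales\<close>

text \<open>
  The sum is \<open>(q\<^sup>d - 1) / (q - 1)\<close> with \<open>q\<close> a primitive root of unity closest to 1, so that
  \<open>q - 1\<close> has the least modulus among all \<open>q\<^sup>d - 1 \<noteq> 0\<close>.
\<close>

lemma norm_geometric_root_ge_1:
  assumes d: "0 < d" "d < n"
  shows "1 \<le> norm (\<Sum>e<d. exp (2 * of_real pi * \<i> / of_nat n) ^ e)"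
proof -
  define q where "q = exp (2 * of_real pi * \<i> / complex_of_nat n)"
  have pow: "norm (q ^ k - 1) = 2 * \<bar>sin (pi * real k / real n)\<bar>" for k
  proof -
    have "q ^ k = exp (\<i> * of_real (2 * pi * real k / real n))"
      by (simp add: q_def exp_of_nat_mult[symmetric] mult_ac)
    then show ?thesis by (simp only: dist_exp_i_1) simp
  qed
  have n: "2 \<le> n" using d by simp
  have le: "sin (pi / real n) \<le> sin (pi * real k / real n)" if k: "0 < k" "2 * k \<le> n" for k
  proof (rule sin_monotone_2pi_le)
    show "pi / real n \<le> pi * real k / real n"
      using k by (intro divide_right_mono) auto
    have "real (2 * k) \<le> real n" using k by (intro of_nat_mono)
    then have "pi * real (2 * k) \<le> pi * real n" by (intro mult_left_mono) auto
    then show "pi * real k / real n \<le> pi / 2" using n by (simp add: field_simps)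
    have "0 \<le> pi / real n" by simp
    then show "- (pi / 2) \<le> pi / real n" using pi_gt_zero by linarith
  qed
  have pos: "0 < sin (pi / real n)"
    using n by (intro sin_gt_zero) (auto simp: field_simps)
  have ge: "sin (pi / real n) \<le> sin (pi * real d / real n)"
  proof (cases "2 * d \<le> n")
    case True
    then show ?thesis using le d by simp
  next
    case False
    have "pi * real d / real n = pi - pi * real (n - d) / real n"
      using d by (simp add: field_simps of_nat_diff)
    then have "sin (pi * real d / real n) = sin (pi * real (n - d) / real n)"
      by (simp only: sin_pi_minus)
    then show ?thesis using le[of "n - d"] False d by simp
  qed
  have q1: "q \<noteq> 1"
    using pow[of 1] pos by auto
  have "norm (q - 1) \<le> norm (q ^ d - 1)"
    using pow[of 1] pow[of d] ge pos by simp
  moreover have "0 < norm (q - 1)" using q1 by simp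
  moreover have "norm (\<Sum>e<d. q ^ e) = norm (q ^ d - 1) / norm (q - 1)"
    using q1 by (simp add: geometric_sum norm_divide)
  ultimately show ?thesis
    unfolding q_def[symmetric] by simp
qed

context vilenkin
begin

abbreviation origin :: "nat \<Rightarrow> nat" where
  "origin \<equiv> \<lambda>_. 0"

lemma origin_in_space [simp]: "origin \<in> space (vil_measure m)"
  using m_pos by (simp add: space_iff)

lemma kern_origin: "kern n x origin = (\<Sum>k<n. vil_psi m k x)"
  by (simp add: kern_def vil_psi_def[of m _ origin] vil_r_def)

lemma kern_M_origin:
  assumes "x \<in> space (vil_measure m)"
  shows "kern (vil_M m N) x origin = of_nat (vil_M m N) * indicator (vil_I m N origin) x"
  using assms m_pos by (subst kern_M) (auto simp: space_iff vil_I_def indicator_def)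

lemma digit_M: "vil_digit m (vil_M m L) j = (if j = L then 1 else 0)"
proof -
  have "1 < m L" using ge2[of L] by linarith
  from digit_single[OF this] show ?thesis by simp
qed

text \<open>
  The cell \<open>cell (Suc L) (vil_M m L)\<close> consists of the points with \<open>x\<^sub>j = 0\<close> for \<open>j < L\<close> and \<open>x\<^sub>L = 1\<close>.
\<close>

lemma norm_kern_ge:
  assumes n: "0 < n" and x: "x \<in> cell (Suc (vil_low m n)) (vil_M m (vil_low m n))"
  shows "real (vil_M m (vil_low m n)) \<le> norm (kern n x origin)"
proof -
  let ?L = "vil_low m n"
  have xL: "x ?L = 1" and xj: "\<And>j. j < ?L \<Longrightarrow> x j = 0" and xs: "x \<in> space (vil_measure m)"
    using x digit_M[of ?L] by (auto simp: vil_I_def)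
  obtain d where d: "n mod vil_M m (Suc ?L) = d * vil_M m ?L" "0 < d" "d < m ?L"
    using mod_Suc_low[OF n] by metis
  have "norm (kern n x origin) = norm (kern (d * vil_M m ?L) x origin)"
    using norm_kern_mod[of x origin ?L n] xs xL m_pos unfolding d(1) by (simp add: space_iff)
  also have "kern (d * vil_M m ?L) x origin
      = (\<Sum>e<d. exp (2 * of_real pi * \<i> / of_nat (m ?L)) ^ e) * of_nat (vil_M m ?L)"
    using d(3) kern_M_origin[OF xs, of ?L] xj xs
    by (subst kern_single) (simp_all add: vil_r_def xL vil_I_def)
  also have "norm \<dots> = norm (\<Sum>e<d. exp (2 * of_real pi * \<i> / complex_of_nat (m ?L)) ^ e) * real (vil_M m ?L)"
    by (simp only: norm_mult norm_of_nat)
  finally show ?thesis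
    using mult_right_mono[OF norm_geometric_root_ge_1[OF d(2,3)], of "real (vil_M m ?L)"] by simp
qed

text \<open>
  A martingale with constant Fourier coefficients on each block \<open>{M\<^sub>a..<M\<^bsub>a+1\<^esub>}\<close>; the block with
  weight \<open>\<beta> a\<close> is, up to normalisation, \<open>\<beta> a\<close> times a \<open>p\<close>-atom on \<open>I\<^sub>a(0)\<close>.
\<close>

definition block_coeff :: "real \<Rightarrow> (nat \<Rightarrow> real) \<Rightarrow> nat \<Rightarrow> complex" where
  "block_coeff p \<beta> k =
     (if k = 0 then 0
      else of_real (\<beta> (vil_high m k) * real (vil_M m (vil_high m k)) powr (1 / p - 1)))"

abbreviation block_martingale :: "real \<Rightarrow> (nat \<Rightarrow> real) \<Rightarrow> nat \<Rightarrow> (nat \<Rightarrow> nat) \<Rightarrow> complex" where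
  "block_martingale p \<beta> \<equiv> trig_martingale (block_coeff p \<beta>)"

lemma block_partial_sum:
  assumes "vil_M m a \<le> n" "n \<le> vil_M m (Suc a)"
  shows "(\<Sum>k<n. block_coeff p \<beta> k * vil_psi m k x)
    = block_martingale p \<beta> a x + of_real (\<beta> a * real (vil_M m a) powr (1 / p - 1))
        * (kern n x origin - kern (vil_M m a) x origin)"
proof -
  have split: "(\<Sum>k<n. g k) = (\<Sum>k<vil_M m a. g k) + (\<Sum>k\<in>{vil_M m a..<n}. g k)" for g :: "nat \<Rightarrow> complex"
    using sum.atLeastLessThan_concat[of 0 "vil_M m a" n g] assms(1) by (simp add: atLeast0LessThan)
  have "block_coeff p \<beta> k = of_real (\<beta> a * real (vil_M m a) powr (1 / p - 1))"
    if "k \<in> {vil_M m a..<n}" for k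
  proof -
    have "vil_high m k = a" "k \<noteq> 0"
      using that assms M_pos[of a] by (auto intro!: high_unique simp del: vil_M.simps)
    then show ?thesis by (simp add: block_coeff_def)
  qed
  then have "(\<Sum>k\<in>{vil_M m a..<n}. block_coeff p \<beta> k * vil_psi m k x)
      = of_real (\<beta> a * real (vil_M m a) powr (1 / p - 1)) * (\<Sum>k\<in>{vil_M m a..<n}. vil_psi m k x)"
    by (simp only: sum_distrib_left cong: sum.cong)
  then show ?thesis
    using split[of "\<lambda>k. vil_psi m k x"] split[of "\<lambda>k. block_coeff p \<beta> k * vil_psi m k x"]
    by (simp add: trig_martingale_def kern_origin)
qed

end

context bounded_vilenkin
begin

lemma norm_block_martingale_le:
  assumes x: "x \<in> space (vil_measure m)" and \<beta>: "\<And>a. 0 \<le> \<beta> a"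
  shows "norm (block_martingale p \<beta> N x)
    \<le> (\<Sum>a<N. real B * \<beta> a * real (vil_M m a) powr (1 / p) * indicator (vil_I m a origin) x)"
proof (induction N)
  case 0
  have "block_coeff p \<beta> 0 = 0" by (simp add: block_coeff_def)
  then show ?case by (simp add: trig_martingale_def)
next
  case (Suc N)
  let ?b = "\<beta> N * real (vil_M m N) powr (1 / p - 1)"
  let ?D = "kern (vil_M m (Suc N)) x origin - kern (vil_M m N) x origin"
  have "?D = of_real (real (vil_M m (Suc N)) * indicator (vil_I m (Suc N) origin) x
      - real (vil_M m N) * indicator (vil_I m N origin) x)"
    unfolding kern_M_origin[OF x] by (simp add: indicator_def)
  then have "norm ?D = \<bar>real (vil_M m (Suc N)) * indicator (vil_I m (Suc N) origin) x
      - real (vil_M m N) * indicator (vil_I m N origin) x\<bar>"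
    by (simp only: norm_of_real)
  also have "\<dots> \<le> real (vil_M m (Suc N)) * indicator (vil_I m N origin) x"
  proof -
    have "vil_I m (Suc N) origin \<subseteq> vil_I m N origin"
      by (auto simp: vil_I_def)
    moreover have "real (vil_M m N) \<le> real (vil_M m (Suc N))"
      using M_mono[of N "Suc N"] by (simp del: vil_M.simps)
    ultimately show ?thesis
      by (auto simp: indicator_def simp del: vil_M.simps)
  qed
  also have "\<dots> \<le> real B * real (vil_M m N) * indicator (vil_I m N origin) x"
    using of_nat_mono[OF M_Suc_le[of N], where 'a = real] by (intro mult_right_mono) simp_all
  finally have D: "norm ?D \<le> real B * real (vil_M m N) * indicator (vil_I m N origin) x" .
  have "block_martingale p \<beta> (Suc N) x = block_martingale p \<beta> N x + of_real ?b * ?D"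
    using block_partial_sum[of N "vil_M m (Suc N)" p \<beta> x] M_mono[of N "Suc N"]
    by (simp only: trig_martingale_def)
  then have "norm (block_martingale p \<beta> (Suc N) x)
      \<le> norm (block_martingale p \<beta> N x) + norm (of_real ?b * ?D)"
    by (simp only: norm_triangle_ineq)
  also have "norm (of_real ?b * ?D) = ?b * norm ?D"
    using \<beta> by (simp add: norm_mult)
  also have "\<dots> \<le> ?b * (real B * real (vil_M m N) * indicator (vil_I m N origin) x)"
    using \<beta> by (intro mult_left_mono D) simp
  also have "\<dots> = real B * \<beta> N * real (vil_M m N) powr (1 / p) * indicator (vil_I m N origin) x"
    using M_pos[of N] by (simp add: powr_diff)
  finally show ?case using Suc by simp
qed

text \<open>
  By \<open>p\<close>-subadditivity the power of the maximal function is at most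
  \<open>\<Sum>\<^sub>a B\<^sup>p (\<beta> a)\<^sup>p M\<^sub>a\<close> times the indicator of \<open>I\<^sub>a(0)\<close>, a set of measure \<open>1 / M\<^sub>a\<close>.
\<close>

lemma block_martingale_in_Hp:
  assumes p: "0 < p" "p < 1" and \<beta>: "\<And>a. 0 \<le> \<beta> a" and summable: "summable (\<lambda>a. \<beta> a powr p)"
  shows "block_martingale p \<beta> \<in> Hp_space m p"
proof -
  let ?g = "\<lambda>a x. ennreal (real B powr p * \<beta> a powr p * real (vil_M m a)) * indicator (vil_I m a origin) x"
  have "(\<integral>\<^sup>+x. ennreal_rpow (max_fun (block_martingale p \<beta>) x) p \<partial>vil_measure m)
      \<le> (\<integral>\<^sup>+x. (\<Sum>a. ?g a x) \<partial>vil_measure m)"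
  proof (intro nn_integral_mono max_fun_rpow_le p)
    fix x N assume x: "x \<in> space (vil_measure m)"
    let ?h = "\<lambda>a. real B * \<beta> a * real (vil_M m a) powr (1 / p) * indicator (vil_I m a origin) x"
    have "norm (block_martingale p \<beta> N x) powr p \<le> (\<Sum>a<N. ?h a) powr p"
      using norm_block_martingale_le[OF x \<beta>] p by (intro powr_mono2) auto
    also have "\<dots> \<le> (\<Sum>a<N. ?h a powr p)"
      using p \<beta> by (intro powr_sum_le) auto
    finally have "ennreal (norm (block_martingale p \<beta> N x) powr p) \<le> ennreal (\<Sum>a<N. ?h a powr p)"
      by (rule ennreal_leI)
    also have "\<dots> = (\<Sum>a<N. ennreal (?h a powr p))"
      by (simp add: sum_ennreal)
    also have "\<dots> = (\<Sum>a<N. ?g a x)"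
      using p \<beta> by (intro sum.cong refl) (simp add: indicator_def powr_mult powr_powr)
    also have "\<dots> \<le> (\<Sum>a. ?g a x)"
      by (intro sum_le_suminf) auto
    finally show "ennreal (norm (block_martingale p \<beta> N x) powr p) \<le> (\<Sum>a. ?g a x)" .
  qed
  also have "\<dots> = (\<Sum>a. \<integral>\<^sup>+x. ?g a x \<partial>vil_measure m)"
    by (intro nn_integral_suminf) measurable
  also have "\<dots> = (\<Sum>a. ennreal (real B powr p * \<beta> a powr p))"
    using M_pos by (intro suminf_cong)
      (simp add: nn_integral_cmult emeasure_vil_I ennreal_mult[symmetric] M_nonzero)
  also have "\<dots> < \<infinity>"
    using summable by (subst suminf_ennreal2) (auto intro!: summable_mult)
  finally have "Hp_norm m p (block_martingale p \<beta>) < \<infinity>"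
    unfolding Hp_norm_def by (auto simp: ennreal_rpow_def)
  then show ?thesis
    using martingale_trig by (simp add: Hp_space_def)
qed

lemma sum_M_powr_le_double:
  assumes "1 \<le> q"
  shows "(\<Sum>a\<le>L. real (vil_M m a) powr q) \<le> 2 * real (vil_M m L) powr q"
proof (induction L)
  case (Suc L)
  have "2 * real (vil_M m L) powr q \<le> 2 powr q * real (vil_M m L) powr q"
    using powr_mono[of 1 q 2] assms by (intro mult_right_mono) auto
  also have "\<dots> = (2 * real (vil_M m L)) powr q"
    by (simp add: powr_mult)
  also have "\<dots> \<le> real (vil_M m (Suc L)) powr q"
    using of_nat_mono[OF M_Suc_ge[of L], where 'a = real] assms by (intro powr_mono2) auto
  finally show ?case using Suc by (simp del: vil_M.simps)
qed simp

text \<open>On a cell that leaves \<open>I\<^sub>L(0)\<close> at position \<open>L\<close> only the blocks up to \<open>L\<close> contribute.\<close>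

lemma norm_block_martingale_le_cell:
  assumes x: "x \<in> cell (Suc L) (vil_M m L)" and p: "0 < p" "p < 1"
    and \<beta>: "\<And>a. 0 \<le> \<beta> a" "\<And>a. \<beta> a \<le> 1"
  shows "norm (block_martingale p \<beta> N x) \<le> 2 * real B * real (vil_M m L) powr (1 / p)"
proof -
  have xs: "x \<in> space (vil_measure m)" and xL: "x L = 1"
    using x digit_M[of L] by (auto simp: vil_I_def)
  have "norm (block_martingale p \<beta> N x)
      \<le> (\<Sum>a<N. real B * \<beta> a * real (vil_M m a) powr (1 / p) * indicator (vil_I m a origin) x)"
    by (intro norm_block_martingale_le xs \<beta>)
  also have "\<dots> \<le> (\<Sum>a<N. if a \<le> L then real B * real (vil_M m a) powr (1 / p) else 0)"
    using xL \<beta> by (intro sum_mono) (auto simp: indicator_def vil_I_def intro!: mult_right_mono mult_left_le)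
  also have "\<dots> \<le> (\<Sum>a\<le>L. real B * real (vil_M m a) powr (1 / p))"
    by (subst sum.inter_filter[symmetric]) (auto intro!: sum_mono2)
  also have "\<dots> \<le> real B * (2 * real (vil_M m L) powr (1 / p))"
    unfolding sum_distrib_left[symmetric] using p by (intro mult_left_mono sum_M_powr_le_double) auto
  finally show ?thesis by simp
qed

text \<open>
  On the cell of the points with \<open>x\<^sub>j = 0\<close> below \<open>\<langle>n\<rangle>\<close> and \<open>x\<^bsub>\<langle>n\<rangle>\<^esub> = 1\<close> the partial sum \<open>S\<^sub>n f\<close> is
  \<open>f\<^bsub>|n|\<^esub>\<close> plus the coefficient of the block \<open>|n|\<close> times the kernel, which has modulus at least
  \<open>M\<^bsub>\<langle>n\<rangle>\<^esub>\<close> there. The hypothesis \<open>large\<close> makes the second summand dominate the first.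
\<close>

lemma weak_norm_vil_S_ge:
  assumes n: "0 < n" and lt: "vil_low m n < vil_high m n" and p: "0 < p" "p < 1" and \<phi>: "0 < \<phi>"
    and \<beta>: "\<And>a. 0 \<le> \<beta> a" "\<And>a. \<beta> a \<le> 1"
    and large: "4 * real B \<le> \<beta> (vil_high m n) *
      (real (vil_M m (vil_high m n)) powr (1 / p - 1) / real (vil_M m (vil_low m n)) powr (1 / p - 1))"
  shows "ennreal (\<beta> (vil_high m n) / (4 * real B powr (1 / p)) *
      (real (vil_M m (vil_high m n)) powr (1 / p - 1)
        / (real (vil_M m (vil_low m n)) powr (1 / p - 1) * \<phi>)))
    \<le> weak_Lp_norm (vil_measure m) p (\<lambda>x. vil_S m n (block_martingale p \<beta>) x / of_real \<phi>)"
proof -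
  let ?H = "vil_high m n" and ?L = "vil_low m n" and ?f = "block_martingale p \<beta>"
  define b where "b = \<beta> ?H * real (vil_M m ?H) powr (1 / p - 1)"
  define E where "E = cell (Suc ?L) (vil_M m ?L)"
  have M_low_pos: "0 < real (vil_M m ?L)" using M_pos by simp
  have Mpowr: "real (vil_M m ?L) powr (1 / p) = real (vil_M m ?L) * real (vil_M m ?L) powr (1 / p - 1)"
    using M_low_pos by (simp add: powr_diff)
  have "4 * real B * real (vil_M m ?L) powr (1 / p - 1) \<le> b"
    using large M_low_pos by (simp add: b_def pos_le_divide_eq)
  then have "4 * real B * real (vil_M m ?L) powr (1 / p - 1) * real (vil_M m ?L) \<le> b * real (vil_M m ?L)"
    by (rule mult_right_mono) simp
  then have big: "4 * real B * real (vil_M m ?L) powr (1 / p) \<le> b * real (vil_M m ?L)"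
    unfolding Mpowr by (simp add: mult_ac)
  have "0 < 4 * real B * real (vil_M m ?L) powr (1 / p)"
    using B_ge2 M_low_pos by simp
  with big have bpos: "0 < b * real (vil_M m ?L)" by linarith
  then have b: "0 < b" using M_low_pos by (simp add: zero_less_mult_iff)
  \<comment> \<open>\<open>b M\<^sub>L\<close> bounds the main term from below and half of it bounds the rest from above; the
    remaining factor 2 only makes the inequality on \<open>E\<close> strict.\<close>
  define l where "l = b * real (vil_M m ?L) / (4 * \<phi>)"
  have l: "0 < l" using bpos \<phi> by (simp add: l_def)
  have large_on_E: "l < norm (vil_S m n ?f x / of_real \<phi>)" if x: "x \<in> E" for x
  proof -
    have xs: "x \<in> space (vil_measure m)" and xL: "x ?L = 1"
      using x digit_M[of ?L] by (auto simp: E_def vil_I_def)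
    have "kern (vil_M m ?H) x origin = 0"
      using xL lt by (simp add: kern_M_origin[OF xs] vil_I_def indicator_def) force
    then have "vil_S m n ?f x = ?f ?H x + of_real b * kern n x origin"
      using block_partial_sum[OF high_bounds(1)[OF n] less_imp_le[OF high_bounds(2)[OF n]], of p \<beta> x]
      by (simp add: vil_S_trig b_def)
    then have "norm (of_real b * kern n x origin) - norm (?f ?H x) \<le> norm (vil_S m n ?f x)"
      using norm_diff_ineq[of "of_real b * kern n x origin" "?f ?H x"] by (simp add: add.commute)
    moreover have "b * real (vil_M m ?L) \<le> norm (of_real b * kern n x origin)"
      using norm_kern_ge[OF n x[unfolded E_def]] b by (simp add: norm_mult)
    moreover have "norm (?f ?H x) \<le> 2 * real B * real (vil_M m ?L) powr (1 / p)"
      by (intro norm_block_martingale_le_cell x[unfolded E_def] p \<beta>)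
    ultimately have "b * real (vil_M m ?L) / 4 < norm (vil_S m n ?f x)"
      using big bpos by linarith
    then show ?thesis
      using \<phi> by (simp add: l_def norm_divide pos_less_divide_eq field_simps)
  qed
  have "\<beta> ?H / (4 * real B powr (1 / p)) * (real (vil_M m ?H) powr (1 / p - 1)
        / (real (vil_M m ?L) powr (1 / p - 1) * \<phi>))
      = l * (1 / (real B * real (vil_M m ?L))) powr (1 / p)"
    using M_low_pos B_ge2 \<phi> by (simp add: l_def b_def powr_divide powr_mult Mpowr)
  also have "\<dots> \<le> l * (1 / real (vil_M m (Suc ?L))) powr (1 / p)"
    using of_nat_mono[OF M_Suc_le[of ?L], where 'a = real] l p M_pos[of "Suc ?L"]
    by (intro mult_left_mono powr_mono2 divide_left_mono) (simp_all del: vil_M.simps)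
  finally have "ennreal (\<beta> ?H / (4 * real B powr (1 / p)) * (real (vil_M m ?H) powr (1 / p - 1)
        / (real (vil_M m ?L) powr (1 / p - 1) * \<phi>)))
      \<le> ennreal (l * (1 / real (vil_M m (Suc ?L))) powr (1 / p))"
    by (rule ennreal_leI)
  also have "\<dots> = ennreal l * ennreal_rpow (emeasure (vil_measure m) E) (1 / p)"
    using l unfolding E_def emeasure_vil_I[OF digit_in_space]
    by (subst ennreal_rpow_ennreal) (simp_all add: ennreal_mult del: vil_M.simps)
  also have "\<dots> \<le> ennreal l * ennreal_rpow (emeasure (vil_measure m)
      {x \<in> space (vil_measure m). l < norm (vil_S m n ?f x / of_real \<phi>)}) (1 / p)"
  proof (intro mult_left_mono ennreal_rpow_mono emeasure_mono)
    show "E \<subseteq> {x \<in> space (vil_measure m). l < norm (vil_S m n ?f x / of_real \<phi>)}"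
      using large_on_E by (auto simp: E_def vil_I_def)
  qed (use p in auto)
  also have "\<dots> \<le> weak_Lp_norm (vil_measure m) p (\<lambda>x. vil_S m n ?f x / of_real \<phi>)"
    unfolding weak_Lp_norm_def using l by (intro SUP_upper) simp
  finally show ?thesis .
qed

end

section \<open>The counterexample\<close>

context bounded_vilenkin
begin

lemma high_ge:
  assumes "vil_M m a \<le> n" shows "a \<le> vil_high m n"
proof (rule ccontr)
  assume "\<not> a \<le> vil_high m n"
  then have "vil_M m (Suc (vil_high m n)) \<le> vil_M m a"
    by (intro M_mono) simp
  moreover have "0 < n" using assms M_pos[of a] by simp
  ultimately show False using high_bounds(2)[of n] assms by linarith
qed

text \<open>
  Levels \<open>h i = |n\<^bsub>\<kappa> i\<^esub>|\<close> are chosen increasing and so that the ratio \<open>Q\<close> is at least of order \<open>4\<^sup>i\<close>;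
  the block martingale with weight \<open>2\<^sup>-\<^sup>i\<close> on level \<open>h i\<close> then has weak norms of order at least \<open>2\<^sup>i\<close>
  along \<open>\<kappa>\<close>.
\<close>

lemma exists_divergent_martingale:
  fixes p :: real and nk :: "nat \<Rightarrow> nat" and \<Phi> :: "nat \<Rightarrow> real"
  defines "Q \<equiv> \<lambda>n. real (vil_M m (vil_high m n)) powr (1 / p - 1)
                      / (real (vil_M m (vil_low m n)) powr (1 / p - 1) * \<Phi> n)"
  assumes p: "0 < p" "p < 1" and nk: "strict_mono nk" "\<And>k. 0 < nk k"
    and \<Phi>: "\<And>n. 0 < \<Phi> n" "mono \<Phi>"
    and limsup: "limsup (\<lambda>k. ereal (Q (nk k))) = \<infinity>"
  shows "\<exists>f\<in>Hp_space m p. (SUP k. weak_Lp_norm (vil_measure m) p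
           (\<lambda>x. vil_S m (nk k) f x / of_real (\<Phi> (nk k)))) = \<infinity>"
proof -
  have frequently: "\<exists>k\<ge>k0. K \<le> Q (nk k)" for K k0
  proof (rule ccontr)
    assume "\<not> (\<exists>k\<ge>k0. K \<le> Q (nk k))"
    then have "Q (nk k) \<le> K" if "k0 \<le> k" for k
      using that by (meson nle_le)
    then have "limsup (\<lambda>k. ereal (Q (nk k))) \<le> ereal K"
      by (intro Limsup_bounded eventually_sequentiallyI[of k0]) simp
    with limsup show False by simp
  qed
  \<comment> \<open>\<open>D\<close> makes the ratio of the two powers at least \<open>4 B 4\<^sup>i\<close> in step \<open>i\<close>, because \<open>\<Phi> \<ge> \<Phi> 0\<close>.\<close>
  define D where "D = 4 * real B / \<Phi> 0"
  have D: "0 < D" using B_ge2 \<Phi> by (simp add: D_def)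
  have next_index: "\<exists>k. D * 4 ^ i \<le> Q (nk k) \<and> a < vil_high m (nk k)" for i a
  proof -
    obtain k where k: "vil_M m (Suc a) \<le> k" "D * 4 ^ i \<le> Q (nk k)"
      using frequently by blast
    have "k \<le> nk k" using nk(1) by (rule strict_mono_imp_increasing)
    then have "Suc a \<le> vil_high m (nk k)"
      using k(1) by (intro high_ge) linarith
    then show ?thesis using k by auto
  qed
  obtain \<kappa> where \<kappa>: "\<And>i. D * 4 ^ i \<le> Q (nk (\<kappa> i))"
      "\<And>i. vil_high m (nk (\<kappa> i)) < vil_high m (nk (\<kappa> (Suc i)))"
    using dependent_nat_choice[where P = "\<lambda>i k. D * 4 ^ i \<le> Q (nk k)"
        and Q = "\<lambda>i k k'. vil_high m (nk k) < vil_high m (nk k')"] next_index by metis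
  define h where "h = (\<lambda>i. vil_high m (nk (\<kappa> i)))"
  have h: "strict_mono h"
    using \<kappa>(2) by (simp add: strict_mono_Suc_iff h_def)
  \<comment> \<open>The weight \<open>2\<^sup>-\<^sup>i\<close> is summable in the power \<open>p\<close> and leaves \<open>2\<^sup>i\<close> of the growth \<open>4\<^sup>i\<close>.\<close>
  define \<beta> :: "nat \<Rightarrow> real" where "\<beta> = (\<lambda>a. if a \<in> range h then (1 / 2) ^ inv h a else 0)"
  have \<beta>_h: "\<beta> (h i) = (1 / 2) ^ i" for i
    using strict_mono_imp_inj_on[OF h] by (simp add: \<beta>_def)
  have \<beta>: "0 \<le> \<beta> a" "\<beta> a \<le> 1" for a
    by (auto simp: \<beta>_def power_le_one)
  have "(\<lambda>i. \<beta> (h i) powr p) = (\<lambda>i. ((1 / 2) powr p) ^ i)"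
    by (simp add: \<beta>_h powr_realpow[symmetric] powr_powr mult.commute)
  moreover have "summable (\<lambda>i. ((1 / 2) powr p :: real) ^ i)"
    using p powr_less_mono2[of p "1 / 2" 1] by (intro summable_geometric) auto
  ultimately have "summable (\<lambda>a. \<beta> a powr p)"
    using summable_mono_reindex[OF h, of "\<lambda>a. \<beta> a powr p"] by (simp add: \<beta>_def)
  then have Hp: "block_martingale p \<beta> \<in> Hp_space m p"
    using p \<beta> by (intro block_martingale_in_Hp)
  have lower: "ennreal (D / (4 * real B powr (1 / p)) * 2 ^ i)
      \<le> weak_Lp_norm (vil_measure m) p (\<lambda>x. vil_S m (nk (\<kappa> i)) (block_martingale p \<beta>) x / of_real (\<Phi> (nk (\<kappa> i))))"
    for i
  proof -
    let ?n = "nk (\<kappa> i)"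
    define R where "R = real (vil_M m (vil_high m ?n)) powr (1 / p - 1) / real (vil_M m (vil_low m ?n)) powr (1 / p - 1)"
    have R_eq: "R = Q ?n * \<Phi> ?n"
      using \<Phi>(1)[of ?n] by (simp add: R_def Q_def)
    have "0 \<le> Q ?n"
      using \<Phi>(1)[of ?n] by (simp add: Q_def)
    then have "Q ?n * \<Phi> ?n \<ge> (D * 4 ^ i) * \<Phi> 0"
      using \<kappa>(1)[of i] D \<Phi>(1)[of 0] monoD[OF \<Phi>(2), of 0 ?n] by (intro mult_mono) auto
    moreover have "(D * 4 ^ i) * \<Phi> 0 = 4 * real B * 4 ^ i"
      using \<Phi>(1)[of 0] by (simp add: D_def)
    ultimately have R: "4 * real B * 4 ^ i \<le> R" by (simp only: R_eq)
    have lt: "vil_low m ?n < vil_high m ?n"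
    proof (rule ccontr)
      assume "\<not> vil_low m ?n < vil_high m ?n"
      then have "vil_low m ?n = vil_high m ?n"
        using low_le_high[OF nk(2)] by (simp add: le_antisym)
      then have "R = 1" using M_nonzero by (simp add: R_def)
      moreover have "4 * real B * 1 \<le> 4 * real B * 4 ^ i"
        by (intro mult_left_mono) auto
      ultimately show False using R B_ge2 by linarith
    qed
    have \<beta>n: "\<beta> (vil_high m ?n) = (1 / 2) ^ i"
      using \<beta>_h[of i] by (simp add: h_def)
    have "4 * real B * 1 \<le> 4 * real B * 2 ^ i"
      by (intro mult_left_mono) auto
    also have "\<dots> = (1 / 2) ^ i * (4 * real B * (2 * 2) ^ i)"
      by (simp only: power_mult_distrib power_one_over) simp
    also have "\<dots> \<le> (1 / 2) ^ i * R"
      using R by (intro mult_left_mono) auto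
    finally have large: "4 * real B \<le> \<beta> (vil_high m ?n) * R"
      by (simp add: \<beta>n)
    have "D / (4 * real B powr (1 / p)) * 2 ^ i = (1 / 2) ^ i / (4 * real B powr (1 / p)) * (D * (2 * 2) ^ i)"
      by (simp only: power_mult_distrib power_one_over) simp
    also have "\<dots> \<le> (1 / 2) ^ i / (4 * real B powr (1 / p)) * Q ?n"
      using \<kappa>(1)[of i] by (intro mult_left_mono) auto
    finally have "ennreal (D / (4 * real B powr (1 / p)) * 2 ^ i)
        \<le> ennreal (\<beta> (vil_high m ?n) / (4 * real B powr (1 / p)) * Q ?n)"
      unfolding \<beta>n by (rule ennreal_leI)
    also have "\<dots> \<le> weak_Lp_norm (vil_measure m) p (\<lambda>x. vil_S m ?n (block_martingale p \<beta>) x / of_real (\<Phi> ?n))"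
      unfolding Q_def using large by (intro weak_norm_vil_S_ge nk lt p \<Phi> \<beta>) (simp add: R_def)
    finally show ?thesis .
  qed
  let ?W = "\<lambda>k. weak_Lp_norm (vil_measure m) p (\<lambda>x. vil_S m (nk k) (block_martingale p \<beta>) x / of_real (\<Phi> (nk k)))"
  have "(SUP k. ?W k) = top"
  proof (rule SUP_eq_top_iff[THEN iffD2], intro allI impI)
    fix y :: ennreal assume "y < top"
    then obtain r where r: "y = ennreal r" "0 \<le> r" by (cases y) auto
    define C where "C = D / (4 * real B powr (1 / p))"
    have C: "0 < C" using D B_ge2 by (simp add: C_def)
    obtain i where "r / C < 2 ^ i" using real_arch_pow[of 2 "r / C"] by auto
    then have "r < C * 2 ^ i" using C by (simp add: pos_divide_less_eq mult.commute)
    then have "y < ennreal (C * 2 ^ i)" using r by (simp add: ennreal_lessI)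
    also have "\<dots> \<le> ?W (\<kappa> i)" using lower[of i] by (simp only: C_def)
    finally show "\<exists>k\<in>UNIV. y < ?W k" by blast
  qed
  with Hp show ?thesis by (auto simp: infinity_ennreal_def)
qed

end

section \<open>Partial sums on Hardy spaces\<close>

theorem theorem1:
  fixes m :: "nat \<Rightarrow> nat"
  assumes m_ge_2: "\<And>k. 2 \<le> m k"
    and m_bounded: "bdd_above (range m)"
  shows
    "(\<forall>p::real. 0 < p \<and> p < 1 \<longrightarrow>
        (\<exists>c::real. 0 < c \<and>
          (\<forall>f\<in>Hp_space m p. \<forall>n::nat. 1 \<le> n \<longrightarrow>
             Hp_norm m p (vil_mart_of m (vil_S m n f))
               \<le> ennreal (c * real (vil_M m (vil_high m n)) powr (1 / p - 1)
                              / real (vil_M m (vil_low m n)) powr (1 / p - 1))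
                 * Hp_norm m p f)))
     \<and>
     (\<forall>(p::real) (nk :: nat \<Rightarrow> nat) (\<Phi> :: nat \<Rightarrow> real).
        0 < p \<and> p < 1 \<and>
        strict_mono nk \<and> (\<forall>k. 0 < nk k) \<and>
        (SUP k. ereal (real (vil_rho m (nk k)))) = \<infinity> \<and>
        (\<forall>n. 0 < \<Phi> n) \<and> mono \<Phi> \<and>
        limsup (\<lambda>k. ereal (real (vil_M m (vil_high m (nk k))) powr (1 / p - 1)
                      / (real (vil_M m (vil_low m (nk k))) powr (1 / p - 1) * \<Phi> (nk k)))) = \<infinity>
        \<longrightarrow> (\<exists>f\<in>Hp_space m p.
              (SUP k. weak_Lp_norm (vil_measure m) p
                        (\<lambda>x. vil_S m (nk k) f x / of_real (\<Phi> (nk k)))) = \<infinity>))"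
proof -
  obtain B where B: "\<And>k. m k \<le> B"
    using m_bounded by (auto simp: bdd_above_def)
  interpret bounded_vilenkin m B
    by unfold_locales (use m_ge_2 B in auto)
  show ?thesis
  proof (intro conjI allI impI; elim conjE)
    fix p :: real assume p: "0 < p" "p < 1"
    let ?c = "(1 + real B / (1 - 2 powr (p - 1))) powr (1 / p)"
    have "0 < 1 + real B / (1 - 2 powr (p - 1))"
      using p by (intro add_pos_nonneg divide_nonneg_nonneg) (auto simp: powr_less_one less_imp_le)
    then have "0 < ?c" by simp
    moreover have "Hp_norm m p (vil_mart_of m (vil_S m n f))
        \<le> ennreal (?c * real (vil_M m (vil_high m n)) powr (1 / p - 1)
            / real (vil_M m (vil_low m n)) powr (1 / p - 1)) * Hp_norm m p f"
      if "f \<in> Hp_space m p" "1 \<le> n" for f n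
      using that p by (intro Hp_norm_vil_S_le) (auto simp: Hp_space_def)
    ultimately show "\<exists>c::real. 0 < c \<and> (\<forall>f\<in>Hp_space m p. \<forall>n::nat. 1 \<le> n \<longrightarrow>
        Hp_norm m p (vil_mart_of m (vil_S m n f))
          \<le> ennreal (c * real (vil_M m (vil_high m n)) powr (1 / p - 1)
              / real (vil_M m (vil_low m n)) powr (1 / p - 1)) * Hp_norm m p f)"
      by blast
  next
    fix p :: real and nk :: "nat \<Rightarrow> nat" and \<Phi> :: "nat \<Rightarrow> real"
    assume "0 < p" "p < 1" "strict_mono nk" "\<forall>k. 0 < nk k" "\<forall>n. 0 < \<Phi> n" "mono \<Phi>"
      "limsup (\<lambda>k. ereal (real (vil_M m (vil_high m (nk k))) powr (1 / p - 1)
          / (real (vil_M m (vil_low m (nk k))) powr (1 / p - 1) * \<Phi> (nk k)))) = \<infinity>"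
    then show "\<exists>f\<in>Hp_space m p. (SUP k. weak_Lp_norm (vil_measure m) p
        (\<lambda>x. vil_S m (nk k) f x / of_real (\<Phi> (nk k)))) = \<infinity>"
      by (intro exists_divergent_martingale) auto
  qed
qed

end
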